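(* Let $\{\lambda_n,\lambda_{n+1},\dots,\lambda_N\}$ be an arbitrary cluster of eigenvalues satisfying the standing assumption $\lambda_{h,n-1}<\lambda_n$ and $\lambda_N<\lambda_{h,N+1}$, let $\beta$ be the quantity defined in the context, and let $C_h$ be a constant for which the a priori error estimate in the context holds. Then $$\delta_b(E,E_h)\le(1+\beta)\,\lambda_N\,C_h^2.$$
   Context: Let $\Omega\subset\mathbb{R}^d$ be a bounded Lipschitz polytope, $(\cdot,\cdot)$ and $\|\cdot\|$ the $L^2(\Omega)$ inner product and norm. Let $0<\lambda_1\le\lambda_2\le\cdots$ be the eigenvalues, repeated according to multiplicity, of the Dirichlet Laplacian in weak form: $(\nabla u_i,\nabla v)=\lambda_i(u_i,v)$ for all $v\in H^1_0(\Omega)$, with corresponding eigenfunctions $u_i\in H^1_0(\Omega)$ normalized by $(u_i,u_j)=\delta_{ij}$. Let $\mathcal{T}_h$ be a conforming simplicial mesh of $\Omega$ and $V_h=\{v_h\in H^1_0(\Omega): v_h|_K\in\mathbb{P}_p(K)\ \text{for all } K\in\mathcal{T}_h\}$, where $\mathbb{P}_p(K)$ is the space of polynomials on $K$ of degree at most $p$. Let $\lambda_{h,1}\le\lambda_{h,2}\le\cdots\le\lambda_{h,\dim V_h}$ (repeated according to multiplicity) and $u_{h,i}\in V_h$ be the exact discrete eigenpairs: $(\nabla u_{h,i},\nabla v_h)=\lambda_{h,i}(u_{h,i},v_h)$ for all $v_h\in V_h$, normalized by $(u_{h,i},u_{h,j})=\delta_{ij}$ and $(\nabla u_{h,i},\nabla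 u_{h,j})=\lambda_{h,i}\delta_{ij}$. A cluster is given by indices $1\le n\le N\le\dim V_h$ (the eigenvalues $\lambda_n,\dots,\lambda_N$ in it need not be equal); $\mathcal{C}=\{n,n+1,\dots,N\}$. Set $E=\operatorname{span}\{u_i:i\in\mathcal{C}\}$, $E_h=\operatorname{span}\{u_{h,i}:i\in\mathcal{C}\}$ and $E^B=\{u\in E:\|u\|=1\}$. Standing assumption: $\lambda_{h,n-1}<\lambda_n$ and $\lambda_N<\lambda_{h,N+1}$ (an inequality involving a discrete eigenvalue index outside $\{1,\dots,\dim V_h\}$ is void). The $L^2$ directed distance is $$\delta_b(E,E_h)=\max_{v\in E,\ \|v\|=1}\ \min_{v_h\in E_h}\|v-v_h\|.$$ $P_h:H^1_0(\Omega)\to V_h$ is the energy projector, defined by $(\nabla(u-P_hu),\nabla v_h)=0$ for all $v_h\in V_h$. The constant $C_h>0$ is such that the following a priori error estimate holds: for every $f\in L^2(\Omega)$, with $u\in H^1_0(\Omega)$ the weak solution of $(\nabla u,\nabla v)=(f,v)$ for all $v\in H^1_0(\Omega)$, $$\|\nabla(u-P_hu)\|\le C_h\|f\|,\qquad \|u-P_hu\|\le C_h\|\nabla(u-P_hu)\|\le C_h^2\|f\|.$$ $\Pi_h^{\mathcal{C}}:H^1_0(\Omega)\to E_h$ is the $L^2(\Omega)$-orthogonal projector onto $E_h$. The quantity $\beta$ is the minimal number $\beta\ge 0$ such that $$\|(I-\Pi_h^{\mathcal{C}})P_hu\|\le\beta\max_{v\in E^B}\|v-P_hv\|\quad\text{for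 all }u\in E^B;$$ if $\|u-P_hu\|=0$ for all $u\in E^B$, then $\beta=0$ by definition. *)

theory Defs
  imports "HOL-Analysis.Analysis"
begin

section \<open>Lebesgue and Sobolev spaces\<close>

text \<open>Elements of the function spaces below are represented by functions on the whole space;
  only their values almost everywhere in the domain matter, and every space is closed under
  changing a representative on a null set. The definitions cover both scalar functions
  (where the inner product is multiplication) and vector fields.\<close>

definition L2 :: "'a::euclidean_space set \<Rightarrow> ('a \<Rightarrow> 'b::euclidean_space) set" where
  "L2 \<Omega> = {f. f \<in> borel_measurable (lebesgue_on \<Omega>) \<and>
               integrable (lebesgue_on \<Omega>) (\<lambda>x. (norm (f x))\<^sup>2)}"

definition L2_inner ::
    "'a::euclidean_space set \<Rightarrow> ('a \<Rightarrow> 'b::euclidean_space) \<Rightarrow> ('a \<Rightarrow> 'b) \<Rightarrow> real" where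
  "L2_inner \<Omega> f g = (LINT x|lebesgue_on \<Omega>. f x \<bullet> g x)"

definition L2_norm :: "'a::euclidean_space set \<Rightarrow> ('a \<Rightarrow> 'b::euclidean_space) \<Rightarrow> real" where
  "L2_norm \<Omega> f = sqrt (L2_inner \<Omega> f f)"

text \<open>Linear span and dimension of spaces of functions modulo equality almost everywhere.\<close>

definition L2_span ::
    "'a::euclidean_space set \<Rightarrow> 'i set \<Rightarrow> ('i \<Rightarrow> 'a \<Rightarrow> real) \<Rightarrow> ('a \<Rightarrow> real) set" where
  "L2_span \<Omega> I w = {v \<in> L2 \<Omega>. \<exists>J c. finite J \<and> J \<subseteq> I \<and>
                       (AE x in lebesgue_on \<Omega>. v x = (\<Sum>i\<in>J. c i * w i x))}"

definition L2_independent ::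
    "'a::euclidean_space set \<Rightarrow> nat \<Rightarrow> (nat \<Rightarrow> 'a \<Rightarrow> real) \<Rightarrow> bool" where
  "L2_independent \<Omega> k w \<longleftrightarrow>
     (\<forall>c. (AE x in lebesgue_on \<Omega>. (\<Sum>i<k. c i * w i x) = 0) \<longrightarrow> (\<forall>i<k. c i = 0))"

text \<open>Meaningful for finite-dimensional spaces only.\<close>

definition L2_dim :: "'a::euclidean_space set \<Rightarrow> ('a \<Rightarrow> real) set \<Rightarrow> nat" where
  "L2_dim \<Omega> V = (GREATEST k. \<exists>w. (\<forall>i<k. w i \<in> V) \<and> L2_independent \<Omega> k w)"

primrec C_k :: "nat \<Rightarrow> ('a::euclidean_space \<Rightarrow> real) \<Rightarrow> bool" where
  "C_k 0 f \<longleftrightarrow> continuous_on UNIV f"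
| "C_k (Suc k) f \<longleftrightarrow> (\<forall>x. f differentiable (at x)) \<and>
                     (\<forall>b\<in>Basis. C_k k (\<lambda>x. frechet_derivative f (at x) b))"

definition test_function :: "'a::euclidean_space set \<Rightarrow> ('a \<Rightarrow> real) \<Rightarrow> bool" where
  "test_function \<Omega> \<phi> \<longleftrightarrow> (\<forall>k. C_k k \<phi>) \<and>
     compact (closure {x. \<phi> x \<noteq> 0}) \<and> closure {x. \<phi> x \<noteq> 0} \<subseteq> \<Omega>"

definition classical_gradient :: "('a::euclidean_space \<Rightarrow> real) \<Rightarrow> 'a \<Rightarrow> 'a" where
  "classical_gradient \<phi> x = (\<Sum>b\<in>Basis. frechet_derivative \<phi> (at x) b *\<^sub>R b)"

definition has_weak_gradient ::
    "'a::euclidean_space set \<Rightarrow> ('a \<Rightarrow> real) \<Rightarrow> ('a \<Rightarrow> 'a) \<Rightarrow> bool" where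
  "has_weak_gradient \<Omega> u g \<longleftrightarrow> u \<in> L2 \<Omega> \<and> g \<in> L2 \<Omega> \<and>
     (\<forall>\<phi>. test_function \<Omega> \<phi> \<longrightarrow> (\<forall>b\<in>Basis.
        (LINT x|lebesgue_on \<Omega>. u x * frechet_derivative \<phi> (at x) b)
          = - (LINT x|lebesgue_on \<Omega>. (g x \<bullet> b) * \<phi> x)))"

text \<open>Membership in the closure of the test functions with respect to the \<open>H\<^sup>1\<close> norm; \<open>g\<close> is the
  weak gradient of \<open>u\<close>, which is unique up to a null set.\<close>

definition has_H10_gradient ::
    "'a::euclidean_space set \<Rightarrow> ('a \<Rightarrow> real) \<Rightarrow> ('a \<Rightarrow> 'a) \<Rightarrow> bool" where
  "has_H10_gradient \<Omega> u g \<longleftrightarrow> has_weak_gradient \<Omega> u g \<and>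
     (\<exists>\<phi>. (\<forall>k::nat. test_function \<Omega> (\<phi> k)) \<and>
          (\<lambda>k. L2_norm \<Omega> (\<phi> k - u)) \<longlonglongrightarrow> 0 \<and>
          (\<lambda>k. L2_norm \<Omega> (classical_gradient (\<phi> k) - g)) \<longlonglongrightarrow> 0)"

definition H10 :: "'a::euclidean_space set \<Rightarrow> ('a \<Rightarrow> real) set" where
  "H10 \<Omega> = {u. \<exists>g. has_H10_gradient \<Omega> u g}"

definition grad :: "'a::euclidean_space set \<Rightarrow> ('a \<Rightarrow> real) \<Rightarrow> 'a \<Rightarrow> 'a" where
  "grad \<Omega> u = (SOME g. has_H10_gradient \<Omega> u g)"

definition energy_inner ::
    "'a::euclidean_space set \<Rightarrow> ('a \<Rightarrow> real) \<Rightarrow> ('a \<Rightarrow> real) \<Rightarrow> real" where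
  "energy_inner \<Omega> u v = L2_inner \<Omega> (grad \<Omega> u) (grad \<Omega> v)"

definition energy_norm :: "'a::euclidean_space set \<Rightarrow> ('a \<Rightarrow> real) \<Rightarrow> real" where
  "energy_norm \<Omega> u = L2_norm \<Omega> (grad \<Omega> u)"


section \<open>Domain, mesh and finite element space\<close>

text \<open>Near each boundary point, the domain lies strictly above the graph, in some direction \<open>e\<close>, of a
  Lipschitz function on the hyperplane orthogonal to \<open>e\<close>.\<close>

definition lipschitz_boundary :: "'a::euclidean_space set \<Rightarrow> bool" where
  "lipschitz_boundary \<Omega> \<longleftrightarrow>
     (\<forall>x\<in>frontier \<Omega>. \<exists>e r L \<gamma>. norm e = 1 \<and> r > 0 \<and> L-lipschitz_on {y. y \<bullet> e = 0} \<gamma> \<and>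
        \<Omega> \<inter> ball x r = {y \<in> ball x r. y \<bullet> e > \<gamma> (y - (y \<bullet> e) *\<^sub>R e)})"

text \<open>The library's \<^const>\<open>polytope\<close> is convex, whereas the closure of the domain is allowed to be
  any finite union of convex polytopes.\<close>

definition bounded_lipschitz_polytope :: "'a::euclidean_space set \<Rightarrow> bool" where
  "bounded_lipschitz_polytope \<Omega> \<longleftrightarrow> open \<Omega> \<and> \<Omega> \<noteq> {} \<and> bounded \<Omega> \<and> lipschitz_boundary \<Omega> \<and>
     (\<exists>\<P>. finite \<P> \<and> (\<forall>S\<in>\<P>. polytope S) \<and> closure \<Omega> = \<Union>\<P>)"

definition conforming_simplicial_mesh ::
    "'a::euclidean_space set \<Rightarrow> 'a set set \<Rightarrow> bool" where
  "conforming_simplicial_mesh \<Omega> \<T> \<longleftrightarrow>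
     triangulation \<T> \<and> (\<forall>K\<in>\<T>. int DIM('a) simplex K) \<and> \<Union>\<T> = closure \<Omega>"

text \<open>Polynomials of total degree at most \<open>p\<close>.\<close>

definition multi_indices :: "nat \<Rightarrow> ('a::euclidean_space \<Rightarrow> nat) set" where
  "multi_indices p = {\<alpha> \<in> Basis \<rightarrow>\<^sub>E UNIV. (\<Sum>b\<in>Basis. \<alpha> b) \<le> p}"

definition polynomials :: "nat \<Rightarrow> ('a::euclidean_space \<Rightarrow> real) set" where
  "polynomials p =
     {q. \<exists>c. \<forall>x. q x = (\<Sum>\<alpha>\<in>multi_indices p. c \<alpha> * (\<Prod>b\<in>Basis. (x \<bullet> b) ^ \<alpha> b))}"

definition fe_space ::
    "'a::euclidean_space set \<Rightarrow> 'a set set \<Rightarrow> nat \<Rightarrow> ('a \<Rightarrow> real) set" where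
  "fe_space \<Omega> \<T> p =
     {v \<in> H10 \<Omega>. \<forall>K\<in>\<T>. \<exists>q\<in>polynomials p. AE x in lebesgue_on \<Omega>. x \<in> K \<longrightarrow> v x = q x}"


section \<open>Eigenvalue problems\<close>

definition weak_eigenfunction ::
    "'a::euclidean_space set \<Rightarrow> ('a \<Rightarrow> real) set \<Rightarrow> real \<Rightarrow> ('a \<Rightarrow> real) \<Rightarrow> bool" where
  "weak_eigenfunction \<Omega> V \<mu> w \<longleftrightarrow>
     w \<in> V \<and> (\<forall>v\<in>V. energy_inner \<Omega> w v = \<mu> * L2_inner \<Omega> w v)"

text \<open>\<open>(lam i, u i)\<close> for \<open>i \<in> I\<close> are the eigenpairs on \<open>V\<close>, in increasing order and
  \<open>L\<^sup>2\<close>-orthonormal. The last clause says that all eigenvalues occur, repeated according to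
  multiplicity: the \<open>u i\<close> with \<open>lam i = \<mu>\<close> form a basis of the eigenspace of \<open>\<mu>\<close>.\<close>

definition eigensystem ::
    "'a::euclidean_space set \<Rightarrow> ('a \<Rightarrow> real) set \<Rightarrow> nat set \<Rightarrow> (nat \<Rightarrow> real) \<Rightarrow>
     (nat \<Rightarrow> 'a \<Rightarrow> real) \<Rightarrow> bool" where
  "eigensystem \<Omega> V I lam u \<longleftrightarrow>
     (\<forall>i\<in>I. lam i > 0) \<and> mono_on I lam \<and>
     (\<forall>i\<in>I. weak_eigenfunction \<Omega> V (lam i) (u i)) \<and>
     (\<forall>i\<in>I. \<forall>j\<in>I. L2_inner \<Omega> (u i) (u j) = of_bool (i = j)) \<and>
     (\<forall>\<mu> w. weak_eigenfunction \<Omega> V \<mu> w \<longrightarrow> w \<in> L2_span \<Omega> {i \<in> I. lam i = \<mu>} u)"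

definition dirichlet_eigensystem ::
    "'a::euclidean_space set \<Rightarrow> (nat \<Rightarrow> real) \<Rightarrow> (nat \<Rightarrow> 'a \<Rightarrow> real) \<Rightarrow> bool" where
  "dirichlet_eigensystem \<Omega> lam u \<longleftrightarrow> eigensystem \<Omega> (H10 \<Omega>) {1..} lam u"

definition discrete_eigensystem ::
    "'a::euclidean_space set \<Rightarrow> ('a \<Rightarrow> real) set \<Rightarrow> (nat \<Rightarrow> real) \<Rightarrow> (nat \<Rightarrow> 'a \<Rightarrow> real) \<Rightarrow> bool"
  where
  "discrete_eigensystem \<Omega> V\<^sub>h lam\<^sub>h u\<^sub>h \<longleftrightarrow>
     eigensystem \<Omega> V\<^sub>h {1..L2_dim \<Omega> V\<^sub>h} lam\<^sub>h u\<^sub>h \<and>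
     (\<forall>i\<in>{1..L2_dim \<Omega> V\<^sub>h}. \<forall>j\<in>{1..L2_dim \<Omega> V\<^sub>h}.
        energy_inner \<Omega> (u\<^sub>h i) (u\<^sub>h j) = lam\<^sub>h i * of_bool (i = j))"

definition unit_functions ::
    "'a::euclidean_space set \<Rightarrow> ('a \<Rightarrow> real) set \<Rightarrow> ('a \<Rightarrow> real) set" where
  "unit_functions \<Omega> E = {v \<in> E. L2_norm \<Omega> v = 1}"

text \<open>For finite-dimensional spaces the supremum and the infimum are attained.\<close>

definition directed_distance ::
    "'a::euclidean_space set \<Rightarrow> ('a \<Rightarrow> real) set \<Rightarrow> ('a \<Rightarrow> real) set \<Rightarrow> real" where
  "directed_distance \<Omega> E E\<^sub>h =
     (SUP v\<in>unit_functions \<Omega> E. INF v\<^sub>h\<in>E\<^sub>h. L2_norm \<Omega> (v - v\<^sub>h))"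


section \<open>Projectors and the a priori estimate\<close>

text \<open>The projectors are determined up to null sets by the following properties.\<close>

definition energy_projector ::
    "'a::euclidean_space set \<Rightarrow> ('a \<Rightarrow> real) set \<Rightarrow> (('a \<Rightarrow> real) \<Rightarrow> ('a \<Rightarrow> real)) \<Rightarrow> bool" where
  "energy_projector \<Omega> V\<^sub>h P\<^sub>h \<longleftrightarrow>
     (\<forall>u\<in>H10 \<Omega>. P\<^sub>h u \<in> V\<^sub>h \<and> (\<forall>v\<^sub>h\<in>V\<^sub>h. energy_inner \<Omega> (u - P\<^sub>h u) v\<^sub>h = 0))"

definition L2_projector ::
    "'a::euclidean_space set \<Rightarrow> ('a \<Rightarrow> real) set \<Rightarrow> (('a \<Rightarrow> real) \<Rightarrow> ('a \<Rightarrow> real)) \<Rightarrow> bool" where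
  "L2_projector \<Omega> E\<^sub>h \<Pi>\<^sub>h \<longleftrightarrow>
     (\<forall>u\<in>H10 \<Omega>. \<Pi>\<^sub>h u \<in> E\<^sub>h \<and> (\<forall>v\<^sub>h\<in>E\<^sub>h. L2_inner \<Omega> (u - \<Pi>\<^sub>h u) v\<^sub>h = 0))"

definition weak_solution ::
    "'a::euclidean_space set \<Rightarrow> ('a \<Rightarrow> real) \<Rightarrow> ('a \<Rightarrow> real) \<Rightarrow> bool" where
  "weak_solution \<Omega> f u \<longleftrightarrow>
     u \<in> H10 \<Omega> \<and> (\<forall>v\<in>H10 \<Omega>. energy_inner \<Omega> u v = L2_inner \<Omega> f v)"

definition a_priori_estimate ::
    "'a::euclidean_space set \<Rightarrow> (('a \<Rightarrow> real) \<Rightarrow> ('a \<Rightarrow> real)) \<Rightarrow> real \<Rightarrow> bool" where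
  "a_priori_estimate \<Omega> P\<^sub>h C\<^sub>h \<longleftrightarrow>
     (\<forall>f\<in>L2 \<Omega>. \<forall>u. weak_solution \<Omega> f u \<longrightarrow>
        energy_norm \<Omega> (u - P\<^sub>h u) \<le> C\<^sub>h * L2_norm \<Omega> f \<and>
        L2_norm \<Omega> (u - P\<^sub>h u) \<le> C\<^sub>h * energy_norm \<Omega> (u - P\<^sub>h u) \<and>
        C\<^sub>h * energy_norm \<Omega> (u - P\<^sub>h u) \<le> C\<^sub>h\<^sup>2 * L2_norm \<Omega> f)"

definition cluster_beta ::
    "'a::euclidean_space set \<Rightarrow> ('a \<Rightarrow> real) set \<Rightarrow> (('a \<Rightarrow> real) \<Rightarrow> ('a \<Rightarrow> real)) \<Rightarrow>
     (('a \<Rightarrow> real) \<Rightarrow> ('a \<Rightarrow> real)) \<Rightarrow> real" where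
  "cluster_beta \<Omega> E P\<^sub>h \<Pi>\<^sub>h =
     (if \<forall>u\<in>unit_functions \<Omega> E. L2_norm \<Omega> (u - P\<^sub>h u) = 0 then 0
      else LEAST \<beta>. \<beta> \<ge> 0 \<and>
        (\<forall>u\<in>unit_functions \<Omega> E. L2_norm \<Omega> (P\<^sub>h u - \<Pi>\<^sub>h (P\<^sub>h u))
            \<le> \<beta> * (SUP v\<in>unit_functions \<Omega> E. L2_norm \<Omega> (v - P\<^sub>h v))))"

end

theory Submission
  imports Defs
begin

text \<open>
  The bound comes from approximating a unit function \<open>v\<close> of the cluster space \<open>E\<close> by
  \<open>\<Pi>\<^sub>h (P\<^sub>h v)\<close> and splitting the error at \<open>P\<^sub>h v\<close>. Writing \<open>v = \<Sum> c\<^sub>i u\<^sub>i\<close>, the function \<open>v\<close> is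
  the weak solution with right-hand side \<open>\<Sum> \<lambda>\<^sub>i c\<^sub>i u\<^sub>i\<close>, whose norm is at most \<open>\<lambda>\<^sub>N\<close> by
  orthonormality. The a priori estimate then bounds \<open>\<parallel>v - P\<^sub>h v\<parallel>\<close> by \<open>\<lambda>\<^sub>N C\<^sub>h\<^sup>2\<close>
  (\<open>cluster_energy_projection_error\<close>). The remaining part
  \<open>\<parallel>P\<^sub>h v - \<Pi>\<^sub>h (P\<^sub>h v)\<parallel>\<close> is at most \<open>\<beta>\<close> times the largest projection error, by the definition
  of \<open>\<beta>\<close>, once it is known that a smallest admissible factor exists
  (\<open>Least_uniform_factor\<close>). It does, because the residuals are bounded on the unit sphere of
  \<open>E\<close> and the largest projection error is positive.

  If all projection errors vanish, \<open>\<beta>\<close> is \<open>0\<close> by convention, and the residual needs a separate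
  argument. Here the \<open>u\<^sub>i\<close> themselves are discrete eigenfunctions, and the separation of the cluster
  from the neighbouring discrete eigenvalues gives \<open>E \<subseteq> E\<^sub>h\<close>
  (\<open>cluster_subset_discrete_cluster\<close>), so that the distance is \<open>0\<close>.

  All of this uses that the energy form is bilinear and does not depend on representatives. The
  gradient is an arbitrary choice among the fields satisfying the closure property, so this rests on
  its uniqueness almost everywhere (\<open>has_H10_gradient_unique\<close>).
\<close>

section \<open>Square-integrable functions\<close>

lemma L2_integrable_inner:
  assumes "f \<in> L2 \<Omega>" "g \<in> L2 \<Omega>"
  shows "integrable (lebesgue_on \<Omega>) (\<lambda>x. f x \<bullet> g x)"
proof (rule Bochner_Integration.integrable_bound)
  show "integrable (lebesgue_on \<Omega>) (\<lambda>x. (norm (f x))\<^sup>2 + (norm (g x))\<^sup>2)"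
    using assms by (auto simp: L2_def)
  show "(\<lambda>x. f x \<bullet> g x) \<in> borel_measurable (lebesgue_on \<Omega>)"
    using assms by (auto simp: L2_def)
  have "\<bar>f x \<bullet> g x\<bar> \<le> (norm (f x))\<^sup>2 + (norm (g x))\<^sup>2" for x
  proof -
    have "\<bar>f x \<bullet> g x\<bar> \<le> norm (f x) * norm (g x)"
      by (rule Cauchy_Schwarz_ineq2)
    moreover have "2 * (norm (f x) * norm (g x)) \<le> (norm (f x))\<^sup>2 + (norm (g x))\<^sup>2"
      using sum_squares_bound[of "norm (f x)" "norm (g x)"] by (simp add: mult.assoc)
    ultimately show ?thesis
      using mult_nonneg_nonneg[OF norm_ge_zero[of "f x"] norm_ge_zero[of "g x"]] by linarith
  qed
  then show "AE x in lebesgue_on \<Omega>. norm (f x \<bullet> g x) \<le> norm ((norm (f x))\<^sup>2 + (norm (g x))\<^sup>2)"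
    by simp
qed

lemma L2_scale: "f \<in> L2 \<Omega> \<Longrightarrow> (\<lambda>x. c *\<^sub>R f x) \<in> L2 \<Omega>"
  by (auto simp: L2_def power_mult_distrib)

lemma L2_add:
  assumes "f \<in> L2 \<Omega>" "g \<in> L2 \<Omega>"
  shows "(\<lambda>x. f x + g x) \<in> L2 \<Omega>"
proof -
  have "integrable (lebesgue_on \<Omega>) (\<lambda>x. (norm (f x))\<^sup>2 + 2 * (f x \<bullet> g x) + (norm (g x))\<^sup>2)"
    using assms L2_integrable_inner[OF assms] by (auto simp: L2_def)
  moreover have "(\<lambda>x. (norm (f x))\<^sup>2 + 2 * (f x \<bullet> g x) + (norm (g x))\<^sup>2) = (\<lambda>x. (norm (f x + g x))\<^sup>2)"
    by (auto simp: power2_norm_eq_inner algebra_simps inner_commute)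
  ultimately show ?thesis
    using assms by (auto simp: L2_def)
qed

lemma L2_diff: "f \<in> L2 \<Omega> \<Longrightarrow> g \<in> L2 \<Omega> \<Longrightarrow> (\<lambda>x. f x - g x) \<in> L2 \<Omega>"
  using L2_add[of f \<Omega> "\<lambda>x. (-1) *\<^sub>R g x"] L2_scale[of g \<Omega> "-1"] by simp

lemma L2_zero: "(\<lambda>x. 0) \<in> L2 \<Omega>"
  by (auto simp: L2_def)

lemma L2_sum: "finite J \<Longrightarrow> (\<And>i. i \<in> J \<Longrightarrow> f i \<in> L2 \<Omega>) \<Longrightarrow> (\<lambda>x. \<Sum>i\<in>J. f i x) \<in> L2 \<Omega>"
  by (induction J rule: finite_induct) (auto simp: L2_zero intro: L2_add)

lemma L2_inner_commute: "L2_inner \<Omega> f g = L2_inner \<Omega> g f"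
  by (simp add: L2_inner_def inner_commute)

lemma L2_inner_add_left:
  assumes "f \<in> L2 \<Omega>" "g \<in> L2 \<Omega>" "h \<in> L2 \<Omega>"
  shows "L2_inner \<Omega> (\<lambda>x. f x + g x) h = L2_inner \<Omega> f h + L2_inner \<Omega> g h"
  using assms by (simp add: L2_inner_def inner_add_left L2_integrable_inner)

lemma L2_inner_diff_left:
  assumes "f \<in> L2 \<Omega>" "g \<in> L2 \<Omega>" "h \<in> L2 \<Omega>"
  shows "L2_inner \<Omega> (\<lambda>x. f x - g x) h = L2_inner \<Omega> f h - L2_inner \<Omega> g h"
  using assms by (simp add: L2_inner_def inner_diff_left L2_integrable_inner)

lemma L2_inner_scale_left: "L2_inner \<Omega> (\<lambda>x. c *\<^sub>R f x) h = c * L2_inner \<Omega> f h"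
  by (simp add: L2_inner_def)

lemma L2_inner_sum_left:
  assumes "\<And>i. i \<in> J \<Longrightarrow> f i \<in> L2 \<Omega>" "h \<in> L2 \<Omega>"
  shows "L2_inner \<Omega> (\<lambda>x. \<Sum>i\<in>J. f i x) h = (\<Sum>i\<in>J. L2_inner \<Omega> (f i) h)"
  using assms by (simp add: L2_inner_def inner_sum_left L2_integrable_inner)

lemma L2_inner_diff_right:
  assumes "f \<in> L2 \<Omega>" "g \<in> L2 \<Omega>" "h \<in> L2 \<Omega>"
  shows "L2_inner \<Omega> h (\<lambda>x. f x - g x) = L2_inner \<Omega> h f - L2_inner \<Omega> h g"
  using assms by (simp add: L2_inner_def inner_diff_right L2_integrable_inner)

lemma L2_inner_scale_right: "L2_inner \<Omega> h (\<lambda>x. c *\<^sub>R f x) = c * L2_inner \<Omega> h f"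
  by (simp add: L2_inner_def)

lemma L2_inner_cong_AE:
  assumes "f \<in> L2 \<Omega>" "f' \<in> L2 \<Omega>" "g \<in> L2 \<Omega>" "g' \<in> L2 \<Omega>"
    and "AE x in lebesgue_on \<Omega>. f x = f' x" "AE x in lebesgue_on \<Omega>. g x = g' x"
  shows "L2_inner \<Omega> f g = L2_inner \<Omega> f' g'"
  unfolding L2_inner_def
proof (rule integral_cong_AE)
  show "AE x in lebesgue_on \<Omega>. f x \<bullet> g x = f' x \<bullet> g' x"
    using assms(5,6) by eventually_elim simp
qed (use assms in \<open>auto simp: L2_def\<close>)

lemma L2_norm_cong_AE:
  assumes "f \<in> L2 \<Omega>" "g \<in> L2 \<Omega>" "AE x in lebesgue_on \<Omega>. f x = g x"
  shows "L2_norm \<Omega> f = L2_norm \<Omega> g"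
  unfolding L2_norm_def using L2_inner_cong_AE[OF assms(1,2,1,2,3,3)] by simp

lemma L2_inner_self_nonneg: "0 \<le> L2_inner \<Omega> f f"
  by (simp add: L2_inner_def)

lemma L2_norm_nonneg: "0 \<le> L2_norm \<Omega> f"
  by (simp add: L2_norm_def L2_inner_self_nonneg)

lemma L2_norm_power2: "(L2_norm \<Omega> f)\<^sup>2 = L2_inner \<Omega> f f"
  by (simp add: L2_norm_def L2_inner_self_nonneg)

lemma L2_norm_scale: "L2_norm \<Omega> (\<lambda>x. c *\<^sub>R f x) = \<bar>c\<bar> * L2_norm \<Omega> f"
  by (simp add: L2_norm_def L2_inner_def real_sqrt_mult mult.assoc[symmetric])

lemma L2_norm_minus_commute: "L2_norm \<Omega> (\<lambda>x. f x - g x) = L2_norm \<Omega> (\<lambda>x. g x - f x)"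
  by (simp add: L2_norm_def L2_inner_def inner_diff_left inner_diff_right algebra_simps)

lemma L2_norm_eq_0_imp_AE:
  assumes "f \<in> L2 \<Omega>" "L2_norm \<Omega> f = 0"
  shows "AE x in lebesgue_on \<Omega>. f x = 0"
proof -
  have "(LINT x|lebesgue_on \<Omega>. f x \<bullet> f x) = 0"
    using assms(2) by (simp add: L2_norm_def L2_inner_def)
  then have "AE x in lebesgue_on \<Omega>. f x \<bullet> f x = 0"
    using integral_nonneg_eq_0_iff_AE[OF L2_integrable_inner[OF assms(1,1)]] by simp
  then show ?thesis
    by simp
qed

lemma L2_Cauchy_Schwarz:
  assumes f: "f \<in> L2 \<Omega>" and g: "g \<in> L2 \<Omega>"
  shows "L2_inner \<Omega> f g \<le> L2_norm \<Omega> f * L2_norm \<Omega> g"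
proof -
  let ?a = "L2_norm \<Omega> f" and ?b = "L2_norm \<Omega> g"
  have expand: "0 \<le> s\<^sup>2 * ?a\<^sup>2 - 2 * s * t * L2_inner \<Omega> f g + t\<^sup>2 * ?b\<^sup>2" for s t
  proof -
    let ?h = "\<lambda>x. s *\<^sub>R f x - t *\<^sub>R g x"
    have sf: "(\<lambda>x. s *\<^sub>R f x) \<in> L2 \<Omega>" and tg: "(\<lambda>x. t *\<^sub>R g x) \<in> L2 \<Omega>"
      using f g by (auto intro: L2_scale)
    have "0 \<le> L2_inner \<Omega> ?h ?h"
      by (rule L2_inner_self_nonneg)
    also have "\<dots> = s * L2_inner \<Omega> f ?h - t * L2_inner \<Omega> g ?h"
      using L2_inner_diff_left[OF sf tg L2_diff[OF sf tg]] by (simp add: L2_inner_scale_left)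
    also have "L2_inner \<Omega> f ?h = s * ?a\<^sup>2 - t * L2_inner \<Omega> f g"
      using L2_inner_diff_right[OF sf tg f] by (simp add: L2_inner_scale_right L2_norm_power2)
    also have "L2_inner \<Omega> g ?h = s * L2_inner \<Omega> f g - t * ?b\<^sup>2"
      using L2_inner_diff_right[OF sf tg g]
      by (simp add: L2_inner_scale_right L2_norm_power2 L2_inner_commute[of \<Omega> g f])
    finally show ?thesis
      by (simp add: power2_eq_square algebra_simps)
  qed
  show ?thesis
  proof (cases "?a = 0 \<or> ?b = 0")
    case False
    then have pos: "?a > 0" "?b > 0"
      using L2_norm_nonneg[of \<Omega> f] L2_norm_nonneg[of \<Omega> g] by auto
    \<comment> \<open>The weights \<open>\<parallel>g\<parallel>\<close> and \<open>\<parallel>f\<parallel>\<close> give both functions the same norm.\<close>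
    have "0 \<le> 2 * (?a * ?b) * (?a * ?b - L2_inner \<Omega> f g)"
      using expand[of ?b ?a] by (simp add: power2_eq_square algebra_simps)
    then show ?thesis
      using mult_pos_pos[OF pos] by (simp add: zero_le_mult_iff)
  next
    case True
    then have "(AE x in lebesgue_on \<Omega>. f x = 0) \<or> (AE x in lebesgue_on \<Omega>. g x = 0)"
      using L2_norm_eq_0_imp_AE f g by blast
    then have "AE x in lebesgue_on \<Omega>. f x \<bullet> g x = 0"
    proof
      assume "AE x in lebesgue_on \<Omega>. f x = 0"
      then show ?thesis by eventually_elim simp
    next
      assume "AE x in lebesgue_on \<Omega>. g x = 0"
      then show ?thesis by eventually_elim simp
    qed
    then have "L2_inner \<Omega> f g = 0"
      by (simp add: L2_inner_def integral_eq_zero_AE)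
    then show ?thesis
      using True by auto
  qed
qed

lemma L2_norm_triangle:
  assumes "f \<in> L2 \<Omega>" "g \<in> L2 \<Omega>"
  shows "L2_norm \<Omega> (\<lambda>x. f x + g x) \<le> L2_norm \<Omega> f + L2_norm \<Omega> g"
proof (rule power2_le_imp_le)
  let ?h = "\<lambda>x. f x + g x"
  have h: "?h \<in> L2 \<Omega>" using assms by (rule L2_add)
  have "(L2_norm \<Omega> ?h)\<^sup>2 = L2_inner \<Omega> ?h f + L2_inner \<Omega> ?h g"
    using L2_inner_add_left[OF assms h]
    by (simp add: L2_norm_power2 L2_inner_commute[of \<Omega> f ?h] L2_inner_commute[of \<Omega> g ?h])
  also have "\<dots> = (L2_norm \<Omega> f)\<^sup>2 + 2 * L2_inner \<Omega> f g + (L2_norm \<Omega> g)\<^sup>2"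
    using assms by (simp add: L2_inner_add_left L2_norm_power2 L2_inner_commute[of \<Omega> g f])
  also have "\<dots> \<le> (L2_norm \<Omega> f + L2_norm \<Omega> g)\<^sup>2"
    using L2_Cauchy_Schwarz[OF assms] by (simp add: power2_sum)
  finally show "(L2_norm \<Omega> ?h)\<^sup>2 \<le> (L2_norm \<Omega> f + L2_norm \<Omega> g)\<^sup>2" .
qed (simp add: L2_norm_nonneg)

lemma L2_norm_triangle_diff:
  assumes "f \<in> L2 \<Omega>" "g \<in> L2 \<Omega>" "h \<in> L2 \<Omega>"
  shows "L2_norm \<Omega> (\<lambda>x. f x - h x) \<le> L2_norm \<Omega> (\<lambda>x. f x - g x) + L2_norm \<Omega> (\<lambda>x. g x - h x)"
  using L2_norm_triangle[OF L2_diff[OF assms(1,2)] L2_diff[OF assms(2,3)]] by simp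

text \<open>Orthogonality to \<open>g\<close> turns \<open>\<parallel>f - g\<parallel>\<^sup>2\<close> into the inner product of \<open>f\<close> and \<open>f - g\<close>. Applied to the
  \<open>L\<^sup>2\<close> projection, this bounds the residuals \<open>P\<^sub>h v - \<Pi>\<^sub>h (P\<^sub>h v)\<close> uniformly, so that \<open>\<beta>\<close> is finite.\<close>

lemma L2_norm_orthogonal_residual_le:
  assumes "f \<in> L2 \<Omega>" "g \<in> L2 \<Omega>" and orth: "L2_inner \<Omega> (\<lambda>x. f x - g x) g = 0"
  shows "L2_norm \<Omega> (\<lambda>x. f x - g x) \<le> L2_norm \<Omega> f"
proof -
  let ?r = "\<lambda>x. f x - g x"
  have r: "?r \<in> L2 \<Omega>" using assms(1,2) by (rule L2_diff)
  have "(L2_norm \<Omega> ?r)\<^sup>2 = L2_inner \<Omega> f ?r"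
    using L2_inner_diff_left[OF assms(1,2) r] orth
    by (simp add: L2_norm_power2 L2_inner_commute[of \<Omega> g ?r])
  also have "\<dots> \<le> L2_norm \<Omega> f * L2_norm \<Omega> ?r"
    by (rule L2_Cauchy_Schwarz[OF assms(1) r])
  finally show ?thesis
    using L2_norm_nonneg[of \<Omega> ?r] L2_norm_nonneg[of \<Omega> f]
    by (cases "L2_norm \<Omega> ?r = 0") (auto simp: power2_eq_square)
qed

lemma L2_norm_orthonormal_sum:
  fixes w :: "'i \<Rightarrow> 'a::euclidean_space \<Rightarrow> real"
  assumes "finite J" and w: "\<And>i. i \<in> J \<Longrightarrow> w i \<in> L2 \<Omega>"
    and on: "\<And>i j. i \<in> J \<Longrightarrow> j \<in> J \<Longrightarrow> L2_inner \<Omega> (w i) (w j) = of_bool (i = j)"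
  shows "(L2_norm \<Omega> (\<lambda>x. \<Sum>i\<in>J. c i * w i x))\<^sup>2 = (\<Sum>i\<in>J. (c i)\<^sup>2)"
proof -
  let ?s = "\<lambda>x. \<Sum>i\<in>J. c i * w i x"
  have cw: "(\<lambda>x. c i * w i x) \<in> L2 \<Omega>" if "i \<in> J" for i
    using L2_scale[OF w[OF that], of "c i"] by simp
  have s: "?s \<in> L2 \<Omega>" using cw \<open>finite J\<close> by (intro L2_sum)
  have scale: "L2_inner \<Omega> (\<lambda>x. c i * w i x) h = c i * L2_inner \<Omega> (w i) h" for i h
    using L2_inner_scale_left[of \<Omega> "c i" "w i" h] by simp
  have coeff: "L2_inner \<Omega> (w i) ?s = c i" if "i \<in> J" for i
  proof -
    have "L2_inner \<Omega> (w i) ?s = (\<Sum>j\<in>J. c j * L2_inner \<Omega> (w j) (w i))"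
      using L2_inner_sum_left[OF cw w[OF that]] by (simp add: L2_inner_commute[of \<Omega> "w i" ?s] scale)
    also have "\<dots> = (\<Sum>j\<in>J. if j = i then c j else 0)"
      using on that by (intro sum.cong) auto
    finally show ?thesis using that \<open>finite J\<close> by simp
  qed
  have "(L2_norm \<Omega> ?s)\<^sup>2 = (\<Sum>i\<in>J. c i * L2_inner \<Omega> (w i) ?s)"
    using L2_inner_sum_left[OF cw s] by (simp add: L2_norm_power2 scale)
  also have "\<dots> = (\<Sum>i\<in>J. (c i)\<^sup>2)"
    using coeff by (intro sum.cong) (auto simp: power2_eq_square)
  finally show ?thesis .
qed

lemma L2_spanI:
  assumes "v \<in> L2 \<Omega>" "finite J" "J \<subseteq> I" "AE x in lebesgue_on \<Omega>. v x = (\<Sum>i\<in>J. c i * w i x)"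
  shows "v \<in> L2_span \<Omega> I w"
  unfolding L2_span_def by (intro CollectI conjI exI[of _ J] exI[of _ c] assms)

lemma L2_spanE:
  assumes "v \<in> L2_span \<Omega> I w"
  obtains J c where "v \<in> L2 \<Omega>" "finite J" "J \<subseteq> I" "AE x in lebesgue_on \<Omega>. v x = (\<Sum>i\<in>J. c i * w i x)"
  using assms unfolding L2_span_def mem_Collect_eq by (elim conjE exE) (rule that)

lemma L2_span_mono: "I \<subseteq> K \<Longrightarrow> L2_span \<Omega> I w \<subseteq> L2_span \<Omega> K w"
  unfolding L2_span_def by blast

lemma L2_span_generator: "w i \<in> L2 \<Omega> \<Longrightarrow> i \<in> I \<Longrightarrow> w i \<in> L2_span \<Omega> I w"
  unfolding L2_span_def by (auto intro!: exI[of _ "{i}"] exI[of _ "\<lambda>_. 1"])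

section \<open>Test functions\<close>

lemma has_derivative_lincomb_frechet:
  fixes f g :: "'a::euclidean_space \<Rightarrow> real"
  assumes "f differentiable (at x)" "g differentiable (at x)"
  shows "((\<lambda>x. a * f x + b * g x) has_derivative
    (\<lambda>h. a * frechet_derivative f (at x) h + b * frechet_derivative g (at x) h)) (at x)"
  using assms[unfolded frechet_derivative_works]
  by (intro has_derivative_add has_derivative_mult_right)

lemma frechet_derivative_lincomb:
  fixes f g :: "'a::euclidean_space \<Rightarrow> real"
  assumes "f differentiable (at x)" "g differentiable (at x)"
  shows "frechet_derivative (\<lambda>x. a * f x + b * g x) (at x) =
    (\<lambda>h. a * frechet_derivative f (at x) h + b * frechet_derivative g (at x) h)"
  using has_derivative_lincomb_frechet[OF assms] by (rule frechet_derivative_at[symmetric])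

lemma C_k_lincomb:
  "C_k k f \<Longrightarrow> C_k k g \<Longrightarrow> C_k k (\<lambda>x. a * f x + b * g x)"
proof (induction k arbitrary: f g)
  case 0
  then show ?case by (simp add: continuous_on_add continuous_on_mult_left)
next
  case (Suc k)
  then have fg: "f differentiable (at x)" "g differentiable (at x)" for x
    by auto
  have "(\<lambda>x. a * f x + b * g x) differentiable (at x)" for x
    using has_derivative_lincomb_frechet[OF fg] by (rule differentiableI)
  then show ?case
    using Suc by (simp add: frechet_derivative_lincomb[OF fg])
qed

lemma test_function_differentiable: "test_function \<Omega> \<phi> \<Longrightarrow> \<phi> differentiable (at x)"
  unfolding test_function_def by (metis C_k.simps(2))

lemma test_function_continuous: "test_function \<Omega> \<phi> \<Longrightarrow> continuous_on UNIV \<phi>"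
  unfolding test_function_def by (metis C_k.simps(1))

lemma test_function_lincomb:
  assumes "test_function \<Omega> \<phi>" "test_function \<Omega> \<psi>"
  shows "test_function \<Omega> (\<lambda>x. a * \<phi> x + b * \<psi> x)"
proof -
  let ?S = "closure {x. \<phi> x \<noteq> 0}" and ?T = "closure {x. \<psi> x \<noteq> 0}"
  let ?U = "closure {x. a * \<phi> x + b * \<psi> x \<noteq> 0}"
  have "?U \<subseteq> closure ({x. \<phi> x \<noteq> 0} \<union> {x. \<psi> x \<noteq> 0})"
    by (intro closure_mono) auto
  then have sub: "?U \<subseteq> ?S \<union> ?T" by simp
  have supp: "compact ?S" "compact ?T" "?S \<subseteq> \<Omega>" "?T \<subseteq> \<Omega>"
    and smooth: "\<forall>k. C_k k \<phi>" "\<forall>k. C_k k \<psi>"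
    using assms by (auto simp only: test_function_def)
  have "bounded ?U"
    using compact_Un[OF supp(1,2)] sub by (blast intro: bounded_subset compact_imp_bounded)
  then have "compact ?U"
    by (simp only: compact_eq_bounded_closed closed_closure simp_thms)
  then show ?thesis
    unfolding test_function_def using supp(3,4) sub smooth C_k_lincomb by blast
qed

text \<open>Smoothness of all orders makes the class of test functions stable under partial derivatives,
  which the proof of uniqueness of gradients below exploits.\<close>

lemma test_function_partial_derivative:
  assumes t: "test_function \<Omega> \<phi>" and b: "b \<in> Basis"
  shows "test_function \<Omega> (\<lambda>x. frechet_derivative \<phi> (at x) b)"
proof -
  let ?S = "closure {x. \<phi> x \<noteq> 0}"
  let ?D = "\<lambda>x. frechet_derivative \<phi> (at x) b"
  have "?D x = 0" if "x \<notin> ?S" for x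
  proof -
    have "(\<phi> has_derivative (\<lambda>_. 0)) (at x)"
      by (rule has_derivative_transform_within_open[of "\<lambda>_. 0" _ _ _ "- ?S"])
         (use that closure_subset[of "{x. \<phi> x \<noteq> 0}"] in auto)
    then show ?thesis
      by (metis frechet_derivative_at)
  qed
  then have sub: "closure {x. ?D x \<noteq> 0} \<subseteq> ?S"
    by (intro closure_minimal) auto
  have "compact ?S" "?S \<subseteq> \<Omega>"
    using t by (auto simp only: test_function_def)
  moreover from this have "bounded (closure {x. ?D x \<noteq> 0})"
    using sub by (blast intro: bounded_subset compact_imp_bounded)
  then have "compact (closure {x. ?D x \<noteq> 0})"
    by (simp only: compact_eq_bounded_closed closed_closure simp_thms)
  moreover have "C_k k ?D" for k
    using t b unfolding test_function_def by (metis C_k.simps(2))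
  ultimately show ?thesis
    unfolding test_function_def using sub by blast
qed

lemma test_function_L2:
  assumes \<Omega>: "open \<Omega>" "bounded \<Omega>" and t: "test_function \<Omega> \<phi>"
  shows "\<phi> \<in> L2 \<Omega>"
proof -
  have lm: "\<Omega> \<in> lmeasurable"
    using \<Omega> by (intro lmeasurable_open)
  have meas: "\<phi> \<in> borel_measurable (lebesgue_on \<Omega>)"
    using test_function_continuous[OF t] lm
    by (intro continuous_imp_measurable_on_sets_lebesgue) (auto intro: continuous_on_subset)
  have "compact (\<phi> ` closure {x. \<phi> x \<noteq> 0})"
    using t test_function_continuous[OF t]
    by (intro compact_continuous_image) (auto simp: test_function_def intro: continuous_on_subset)
  then have "bounded (\<phi> ` closure {x. \<phi> x \<noteq> 0})"
    by (rule compact_imp_bounded)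
  then obtain B where B: "\<And>x. x \<in> closure {x. \<phi> x \<noteq> 0} \<Longrightarrow> norm (\<phi> x) \<le> B"
    unfolding bounded_iff by blast
  have le: "(norm (\<phi> x))\<^sup>2 \<le> B\<^sup>2" for x
  proof (cases "\<phi> x = 0")
    case False
    then have "norm (\<phi> x) \<le> B"
      using B[of x] closure_subset[of "{x. \<phi> x \<noteq> 0}"] by auto
    then show ?thesis by (intro power_mono) auto
  qed simp
  interpret finite_measure "lebesgue_on \<Omega>"
    using lm by (rule finite_measure_lebesgue_on)
  have "integrable (lebesgue_on \<Omega>) (\<lambda>x. (norm (\<phi> x))\<^sup>2)"
    using meas le by (intro integrable_const_bound[where B = "B\<^sup>2"]) auto
  with meas show ?thesis
    by (simp add: L2_def)
qed

lemma classical_gradient_L2: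
  assumes \<Omega>: "open \<Omega>" "bounded \<Omega>" and t: "test_function \<Omega> \<phi>"
  shows "classical_gradient \<phi> \<in> L2 \<Omega>"
proof -
  have "(\<lambda>x. frechet_derivative \<phi> (at x) b *\<^sub>R b) \<in> L2 \<Omega>" if "b \<in> Basis" for b
    using test_function_L2[OF \<Omega> test_function_partial_derivative[OF t that]] that
    by (auto simp: L2_def)
  then have "(\<lambda>x. \<Sum>b\<in>Basis. frechet_derivative \<phi> (at x) b *\<^sub>R b) \<in> L2 \<Omega>"
    by (intro L2_sum) auto
  then show ?thesis
    by (simp add: classical_gradient_def[abs_def])
qed

section \<open>Gradients of functions vanishing on the boundary\<close>

lemma has_H10_gradient_L2: "has_H10_gradient \<Omega> u g \<Longrightarrow> u \<in> L2 \<Omega> \<and> g \<in> L2 \<Omega>"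
  by (simp add: has_H10_gradient_def has_weak_gradient_def)

lemma has_H10_gradient_by_parts:
  "has_H10_gradient \<Omega> u g \<Longrightarrow> test_function \<Omega> \<phi> \<Longrightarrow> b \<in> Basis \<Longrightarrow>
    (LINT x|lebesgue_on \<Omega>. u x * frechet_derivative \<phi> (at x) b)
      = - (LINT x|lebesgue_on \<Omega>. (g x \<bullet> b) * \<phi> x)"
  by (simp add: has_H10_gradient_def has_weak_gradient_def)

lemma H10_L2: "u \<in> H10 \<Omega> \<Longrightarrow> u \<in> L2 \<Omega>"
  by (auto simp: H10_def dest: has_H10_gradient_L2)

lemma L2_component: "g \<in> L2 \<Omega> \<Longrightarrow> b \<in> Basis \<Longrightarrow> (\<lambda>x. g x \<bullet> b) \<in> L2 \<Omega>"
proof -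
  assume g: "g \<in> L2 \<Omega>" and b: "b \<in> Basis"
  have "integrable (lebesgue_on \<Omega>) (\<lambda>x. (norm (g x \<bullet> b))\<^sup>2)"
  proof (rule Bochner_Integration.integrable_bound)
    show "integrable (lebesgue_on \<Omega>) (\<lambda>x. (norm (g x))\<^sup>2)"
      using g by (simp add: L2_def)
    show "AE x in lebesgue_on \<Omega>. norm ((norm (g x \<bullet> b))\<^sup>2) \<le> norm ((norm (g x))\<^sup>2)"
      using Basis_le_norm[OF b] by (simp add: abs_le_square_iff[symmetric])
  qed (use g in \<open>auto simp: L2_def\<close>)
  moreover have "(\<lambda>x. g x \<bullet> b) \<in> borel_measurable (lebesgue_on \<Omega>)"
    using g by (auto simp: L2_def)
  ultimately show ?thesis by (simp add: L2_def)
qed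

lemma L2_integrable_mult:
  fixes f g :: "'a::euclidean_space \<Rightarrow> real"
  shows "f \<in> L2 \<Omega> \<Longrightarrow> g \<in> L2 \<Omega> \<Longrightarrow> integrable (lebesgue_on \<Omega>) (\<lambda>x. f x * g x)"
  using L2_integrable_inner[of f \<Omega> g] by simp

lemma tendsto_L2_norm_lincomb:
  fixes F G :: "nat \<Rightarrow> 'a::euclidean_space \<Rightarrow> 'b::euclidean_space"
  assumes "\<And>k. F k \<in> L2 \<Omega>" "\<And>k. G k \<in> L2 \<Omega>" "f \<in> L2 \<Omega>" "g \<in> L2 \<Omega>"
    and F: "(\<lambda>k. L2_norm \<Omega> (F k - f)) \<longlonglongrightarrow> 0" and G: "(\<lambda>k. L2_norm \<Omega> (G k - g)) \<longlonglongrightarrow> 0"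
  shows "(\<lambda>k. L2_norm \<Omega> ((\<lambda>x. a *\<^sub>R F k x + b *\<^sub>R G k x) - (\<lambda>x. a *\<^sub>R f x + b *\<^sub>R g x))) \<longlonglongrightarrow> 0"
proof (rule tendsto_sandwich)
  show "\<forall>\<^sub>F k in sequentially. 0 \<le>
      L2_norm \<Omega> ((\<lambda>x. a *\<^sub>R F k x + b *\<^sub>R G k x) - (\<lambda>x. a *\<^sub>R f x + b *\<^sub>R g x))"
    by (simp add: L2_norm_nonneg)
  have "L2_norm \<Omega> ((\<lambda>x. a *\<^sub>R F k x + b *\<^sub>R G k x) - (\<lambda>x. a *\<^sub>R f x + b *\<^sub>R g x))
      \<le> \<bar>a\<bar> * L2_norm \<Omega> (F k - f) + \<bar>b\<bar> * L2_norm \<Omega> (G k - g)" for k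
  proof -
    have "L2_norm \<Omega> (\<lambda>x. a *\<^sub>R (F k x - f x) + b *\<^sub>R (G k x - g x))
        \<le> \<bar>a\<bar> * L2_norm \<Omega> (\<lambda>x. F k x - f x) + \<bar>b\<bar> * L2_norm \<Omega> (\<lambda>x. G k x - g x)"
      using L2_norm_triangle[OF L2_scale[OF L2_diff[of "F k" \<Omega> f], of a]
          L2_scale[OF L2_diff[of "G k" \<Omega> g], of b]] assms(1-4)
      by (simp add: L2_norm_scale)
    moreover have "(\<lambda>x. a *\<^sub>R (F k x - f x) + b *\<^sub>R (G k x - g x))
        = (\<lambda>x. a *\<^sub>R F k x + b *\<^sub>R G k x) - (\<lambda>x. a *\<^sub>R f x + b *\<^sub>R g x)"
      by (simp add: fun_diff_def algebra_simps)
    ultimately show ?thesis by (simp add: fun_diff_def)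
  qed
  then show "\<forall>\<^sub>F k in sequentially.
      L2_norm \<Omega> ((\<lambda>x. a *\<^sub>R F k x + b *\<^sub>R G k x) - (\<lambda>x. a *\<^sub>R f x + b *\<^sub>R g x))
      \<le> \<bar>a\<bar> * L2_norm \<Omega> (F k - f) + \<bar>b\<bar> * L2_norm \<Omega> (G k - g)"
    by simp
  show "(\<lambda>k. \<bar>a\<bar> * L2_norm \<Omega> (F k - f) + \<bar>b\<bar> * L2_norm \<Omega> (G k - g)) \<longlonglongrightarrow> 0"
    using tendsto_add[OF tendsto_mult_right_zero[OF F] tendsto_mult_right_zero[OF G]] by simp
qed simp

lemma has_H10_gradient_lincomb:
  assumes \<Omega>: "open \<Omega>" "bounded \<Omega>"
    and u: "has_H10_gradient \<Omega> u g" and v: "has_H10_gradient \<Omega> v h"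
  shows "has_H10_gradient \<Omega> (\<lambda>x. a * u x + b * v x) (\<lambda>x. a *\<^sub>R g x + b *\<^sub>R h x)"
proof -
  obtain \<phi> where \<phi>: "\<And>k::nat. test_function \<Omega> (\<phi> k)" "(\<lambda>k. L2_norm \<Omega> (\<phi> k - u)) \<longlonglongrightarrow> 0"
      "(\<lambda>k. L2_norm \<Omega> (classical_gradient (\<phi> k) - g)) \<longlonglongrightarrow> 0"
    using u by (auto simp: has_H10_gradient_def)
  obtain \<psi> where \<psi>: "\<And>k::nat. test_function \<Omega> (\<psi> k)" "(\<lambda>k. L2_norm \<Omega> (\<psi> k - v)) \<longlonglongrightarrow> 0"
      "(\<lambda>k. L2_norm \<Omega> (classical_gradient (\<psi> k) - h)) \<longlonglongrightarrow> 0"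
    using v by (auto simp: has_H10_gradient_def)
  have L: "u \<in> L2 \<Omega>" "g \<in> L2 \<Omega>" "v \<in> L2 \<Omega>" "h \<in> L2 \<Omega>"
    using u v by (auto dest: has_H10_gradient_L2)
  let ?w = "\<lambda>x. a * u x + b * v x" and ?q = "\<lambda>x. a *\<^sub>R g x + b *\<^sub>R h x"
  have wL: "?w \<in> L2 \<Omega>"
    using L2_add[OF L2_scale[OF L(1), of a] L2_scale[OF L(3), of b]] by simp
  have qL: "?q \<in> L2 \<Omega>"
    using L by (intro L2_add L2_scale)
  have weak: "(LINT x|lebesgue_on \<Omega>. ?w x * frechet_derivative \<eta> (at x) e)
      = - (LINT x|lebesgue_on \<Omega>. (?q x \<bullet> e) * \<eta> x)"
    if t: "test_function \<Omega> \<eta>" and e: "e \<in> Basis" for \<eta> e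
  proof -
    let ?D = "\<lambda>x. frechet_derivative \<eta> (at x) e"
    have DL: "?D \<in> L2 \<Omega>" and cL: "\<eta> \<in> L2 \<Omega>"
      using test_function_L2[OF \<Omega>] test_function_partial_derivative[OF t e] t by auto
    have int: "integrable (lebesgue_on \<Omega>) (\<lambda>x. u x * ?D x)" "integrable (lebesgue_on \<Omega>) (\<lambda>x. v x * ?D x)"
      "integrable (lebesgue_on \<Omega>) (\<lambda>x. (g x \<bullet> e) * \<eta> x)" "integrable (lebesgue_on \<Omega>) (\<lambda>x. (h x \<bullet> e) * \<eta> x)"
      using L DL cL e by (auto intro!: L2_integrable_mult L2_component)
    have "(LINT x|lebesgue_on \<Omega>. ?w x * ?D x)
        = (LINT x|lebesgue_on \<Omega>. a * (u x * ?D x) + b * (v x * ?D x))"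
      by (simp add: algebra_simps)
    also have "\<dots> = a * (LINT x|lebesgue_on \<Omega>. u x * ?D x) + b * (LINT x|lebesgue_on \<Omega>. v x * ?D x)"
      using int by simp
    also have "\<dots> = a * - (LINT x|lebesgue_on \<Omega>. (g x \<bullet> e) * \<eta> x)
        + b * - (LINT x|lebesgue_on \<Omega>. (h x \<bullet> e) * \<eta> x)"
      by (simp only: has_H10_gradient_by_parts[OF u t e] has_H10_gradient_by_parts[OF v t e])
    also have "\<dots> = - (LINT x|lebesgue_on \<Omega>. a * ((g x \<bullet> e) * \<eta> x) + b * ((h x \<bullet> e) * \<eta> x))"
      using int by simp
    also have "\<dots> = - (LINT x|lebesgue_on \<Omega>. (?q x \<bullet> e) * \<eta> x)"
      by (simp add: algebra_simps inner_add_left)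
    finally show ?thesis .
  qed
  let ?\<eta> = "\<lambda>k x. a * \<phi> k x + b * \<psi> k x"
  have t: "test_function \<Omega> (?\<eta> k)" for k
    using \<phi>(1) \<psi>(1) by (rule test_function_lincomb)
  have lim0: "(\<lambda>k. L2_norm \<Omega> (?\<eta> k - ?w)) \<longlonglongrightarrow> 0"
    using tendsto_L2_norm_lincomb[OF _ _ L(1,3) \<phi>(2) \<psi>(2), of a b]
      test_function_L2[OF \<Omega> \<phi>(1)] test_function_L2[OF \<Omega> \<psi>(1)] by simp
  have "classical_gradient (?\<eta> k) = (\<lambda>x. a *\<^sub>R classical_gradient (\<phi> k) x + b *\<^sub>R classical_gradient (\<psi> k) x)" for k
    using test_function_differentiable[OF \<phi>(1)] test_function_differentiable[OF \<psi>(1)]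
    by (auto simp: classical_gradient_def frechet_derivative_lincomb scaleR_sum_right
        scaleR_add_left sum.distrib)
  then have lim1: "(\<lambda>k. L2_norm \<Omega> (classical_gradient (?\<eta> k) - ?q)) \<longlonglongrightarrow> 0"
    using tendsto_L2_norm_lincomb[OF _ _ L(2,4) \<phi>(3) \<psi>(3), of a b]
      classical_gradient_L2[OF \<Omega> \<phi>(1)] classical_gradient_L2[OF \<Omega> \<psi>(1)] by simp
  show ?thesis
    unfolding has_H10_gradient_def has_weak_gradient_def
    by (intro conjI allI impI ballI exI[of _ ?\<eta>] wL qL weak t lim0 lim1)
qed

lemma has_H10_gradient_AE:
  assumes \<Omega>: "open \<Omega>" "bounded \<Omega>"
    and u: "has_H10_gradient \<Omega> u g" and v: "v \<in> L2 \<Omega>"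
    and ae: "AE x in lebesgue_on \<Omega>. v x = u x"
  shows "has_H10_gradient \<Omega> v g"
proof -
  have uL: "u \<in> L2 \<Omega>" using has_H10_gradient_L2[OF u] by simp
  have "(LINT x|lebesgue_on \<Omega>. v x * frechet_derivative \<eta> (at x) e)
      = (LINT x|lebesgue_on \<Omega>. u x * frechet_derivative \<eta> (at x) e)"
    if "test_function \<Omega> \<eta>" "e \<in> Basis" for \<eta> e
    using L2_inner_cong_AE[OF v uL _ _ ae, of "\<lambda>x. frechet_derivative \<eta> (at x) e"]
      test_function_L2[OF \<Omega> test_function_partial_derivative[OF that]]
    by (simp add: L2_inner_def)
  moreover have "L2_norm \<Omega> (\<phi> - v) = L2_norm \<Omega> (\<phi> - u)" if "test_function \<Omega> \<phi>" for \<phi>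
  proof (rule L2_norm_cong_AE)
    show "AE x in lebesgue_on \<Omega>. (\<phi> - v) x = (\<phi> - u) x"
      using ae by eventually_elim simp
  qed (use L2_diff[OF test_function_L2[OF \<Omega> that]] v uL in \<open>auto simp: fun_diff_def\<close>)
  ultimately show ?thesis
    using u v unfolding has_H10_gradient_def has_weak_gradient_def by auto
qed

text \<open>The difference \<open>d\<close> of two gradients of \<open>u\<close> is orthogonal to every field whose components are
  test functions. Since partial derivatives of test functions are test functions, this includes the
  gradients of the approximating sequences, whose difference converges to \<open>d\<close>. So \<open>d\<close> is orthogonal
  to itself. The approximating sequences thus replace the density of test functions in \<open>L\<^sup>2\<close>.\<close>

lemma has_H10_gradient_unique:
  assumes \<Omega>: "open \<Omega>" "bounded \<Omega>"
    and g: "has_H10_gradient \<Omega> u g" and h: "has_H10_gradient \<Omega> u h"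
  shows "AE x in lebesgue_on \<Omega>. g x = h x"
proof -
  obtain \<phi> where \<phi>: "\<And>k::nat. test_function \<Omega> (\<phi> k)"
      "(\<lambda>k. L2_norm \<Omega> (classical_gradient (\<phi> k) - g)) \<longlonglongrightarrow> 0"
    using g by (auto simp: has_H10_gradient_def)
  obtain \<psi> where \<psi>: "\<And>k::nat. test_function \<Omega> (\<psi> k)"
      "(\<lambda>k. L2_norm \<Omega> (classical_gradient (\<psi> k) - h)) \<longlonglongrightarrow> 0"
    using h by (auto simp: has_H10_gradient_def)
  have gL: "g \<in> L2 \<Omega>" and hL: "h \<in> L2 \<Omega>"
    using g h by (auto dest: has_H10_gradient_L2)
  let ?d = "\<lambda>x. g x - h x"
  have dL: "?d \<in> L2 \<Omega>" using gL hL by (rule L2_diff)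
  have orth: "L2_inner \<Omega> ?d (classical_gradient \<eta>) = 0" if t: "test_function \<Omega> \<eta>" for \<eta>
  proof -
    let ?D = "\<lambda>b x. frechet_derivative \<eta> (at x) b"
    have comp: "integrable (lebesgue_on \<Omega>) (\<lambda>x. (?d x \<bullet> b) * ?D b x)"
        "(LINT x|lebesgue_on \<Omega>. (?d x \<bullet> b) * ?D b x) = 0" if b: "b \<in> Basis" for b
    proof -
      have t': "test_function \<Omega> (?D b)"
        using t b by (rule test_function_partial_derivative)
      have DL: "?D b \<in> L2 \<Omega>"
        using \<Omega> t' by (rule test_function_L2)
      have int: "integrable (lebesgue_on \<Omega>) (\<lambda>x. (g x \<bullet> b) * ?D b x)"
          "integrable (lebesgue_on \<Omega>) (\<lambda>x. (h x \<bullet> b) * ?D b x)"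
        using DL gL hL b by (auto intro!: L2_integrable_mult L2_component)
      have "(LINT x|lebesgue_on \<Omega>. (g x \<bullet> b) * ?D b x) = (LINT x|lebesgue_on \<Omega>. (h x \<bullet> b) * ?D b x)"
        using has_H10_gradient_by_parts[OF g t' b] has_H10_gradient_by_parts[OF h t' b] by simp
      then show "(LINT x|lebesgue_on \<Omega>. (?d x \<bullet> b) * ?D b x) = 0"
        using int by (simp add: inner_diff_left left_diff_distrib)
      show "integrable (lebesgue_on \<Omega>) (\<lambda>x. (?d x \<bullet> b) * ?D b x)"
        using int by (simp add: inner_diff_left left_diff_distrib)
    qed
    have "L2_inner \<Omega> ?d (classical_gradient \<eta>)
        = (LINT x|lebesgue_on \<Omega>. (\<Sum>b\<in>Basis. (?d x \<bullet> b) * ?D b x))"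
      unfolding L2_inner_def
      by (intro Bochner_Integration.integral_cong refl)
         (simp add: classical_gradient_def inner_sum_right mult.commute)
    also have "\<dots> = 0"
      using comp by simp
    finally show ?thesis .
  qed
  have bound: "L2_norm \<Omega> ?d \<le> L2_norm \<Omega> (classical_gradient (\<phi> k) - g)
      + L2_norm \<Omega> (classical_gradient (\<psi> k) - h)" for k
  proof -
    let ?A = "classical_gradient (\<phi> k)" and ?B = "classical_gradient (\<psi> k)"
    have AL: "?A \<in> L2 \<Omega>" and BL: "?B \<in> L2 \<Omega>"
      using classical_gradient_L2[OF \<Omega>] \<phi>(1) \<psi>(1) by auto
    let ?r = "\<lambda>x. (g x - ?A x) + (?B x - h x)"
    have rL: "?r \<in> L2 \<Omega>" using gL hL AL BL by (intro L2_add L2_diff)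
    have "(L2_norm \<Omega> ?d)\<^sup>2 = L2_inner \<Omega> (\<lambda>x. ?r x + (?A x - ?B x)) ?d"
      by (simp add: L2_norm_power2)
    also have "\<dots> = L2_inner \<Omega> ?r ?d + (L2_inner \<Omega> ?A ?d - L2_inner \<Omega> ?B ?d)"
      using L2_inner_add_left[OF rL L2_diff[OF AL BL] dL] L2_inner_diff_left[OF AL BL dL] by simp
    also have "\<dots> = L2_inner \<Omega> ?r ?d"
      using orth[OF \<phi>(1)[of k]] orth[OF \<psi>(1)[of k]] by (simp add: L2_inner_commute)
    also have "\<dots> \<le> L2_norm \<Omega> ?r * L2_norm \<Omega> ?d"
      by (rule L2_Cauchy_Schwarz[OF rL dL])
    finally have "L2_norm \<Omega> ?d \<le> L2_norm \<Omega> ?r"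
      using L2_norm_nonneg[of \<Omega> ?d] L2_norm_nonneg[of \<Omega> ?r]
      by (cases "L2_norm \<Omega> ?d = 0") (auto simp: power2_eq_square)
    also have "\<dots> \<le> L2_norm \<Omega> (\<lambda>x. g x - ?A x) + L2_norm \<Omega> (\<lambda>x. ?B x - h x)"
      using gL hL AL BL by (intro L2_norm_triangle L2_diff)
    finally show ?thesis
      by (simp add: fun_diff_def L2_norm_minus_commute[of \<Omega> g])
  qed
  have "L2_norm \<Omega> ?d \<le> 0"
    by (rule LIMSEQ_le_const[OF tendsto_add_zero[OF \<phi>(2) \<psi>(2)]]) (use bound in auto)
  then have "AE x in lebesgue_on \<Omega>. ?d x = 0"
    using L2_norm_nonneg[of \<Omega> ?d] dL by (intro L2_norm_eq_0_imp_AE) auto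
  then show ?thesis by simp
qed

lemma has_H10_gradient_grad: "u \<in> H10 \<Omega> \<Longrightarrow> has_H10_gradient \<Omega> u (grad \<Omega> u)"
  using someI_ex[of "has_H10_gradient \<Omega> u"] by (simp add: H10_def grad_def)

lemma energy_inner_eq:
  assumes \<Omega>: "open \<Omega>" "bounded \<Omega>"
    and u: "has_H10_gradient \<Omega> u g" and v: "v \<in> H10 \<Omega>"
  shows "energy_inner \<Omega> u v = L2_inner \<Omega> g (grad \<Omega> v)"
proof -
  have "u \<in> H10 \<Omega>" using u by (auto simp: H10_def)
  note gu = has_H10_gradient_grad[OF this] and gv = has_H10_gradient_grad[OF v]
  show ?thesis
    unfolding energy_inner_def
    using has_H10_gradient_L2[OF u] has_H10_gradient_L2[OF gu] has_H10_gradient_L2[OF gv]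
    by (intro L2_inner_cong_AE has_H10_gradient_unique[OF \<Omega> gu u]) auto
qed

lemma H10_AE_eq:
  assumes \<Omega>: "open \<Omega>" "bounded \<Omega>"
    and u: "u \<in> H10 \<Omega>" and v: "v \<in> L2 \<Omega>" and ae: "AE x in lebesgue_on \<Omega>. v x = u x"
  shows "v \<in> H10 \<Omega>" and "w \<in> H10 \<Omega> \<Longrightarrow> energy_inner \<Omega> v w = energy_inner \<Omega> u w"
proof -
  note g = has_H10_gradient_AE[OF \<Omega> has_H10_gradient_grad[OF u] v ae]
  show "v \<in> H10 \<Omega>" using g by (auto simp: H10_def)
  show "energy_inner \<Omega> v w = energy_inner \<Omega> u w" if "w \<in> H10 \<Omega>"
    using energy_inner_eq[OF \<Omega> g that] by (simp add: energy_inner_def)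
qed

lemma has_H10_gradient_sum:
  assumes \<Omega>: "open \<Omega>" "bounded \<Omega>" and "finite J"
    and "\<And>i. i \<in> J \<Longrightarrow> has_H10_gradient \<Omega> (w i) (g i)"
  shows "has_H10_gradient \<Omega> (\<lambda>x. \<Sum>i\<in>J. c i * w i x) (\<lambda>x. \<Sum>i\<in>J. c i *\<^sub>R g i x)"
  using assms(3,4)
proof (induction J rule: finite_induct)
  case empty
  have "test_function \<Omega> (\<lambda>x. 0)"
  proof -
    have "C_k k (\<lambda>x::'a. 0::real)" for k
      by (induction k) (auto simp: frechet_derivative_const)
    then show ?thesis by (simp add: test_function_def)
  qed
  moreover have "classical_gradient (\<lambda>x::'a. 0) = (\<lambda>x. 0)"
    by (simp add: classical_gradient_def[abs_def] frechet_derivative_const)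
  ultimately show ?case
    by (auto simp: has_H10_gradient_def has_weak_gradient_def L2_zero L2_norm_def L2_inner_def
        intro!: exI[of _ "\<lambda>k x. 0"])
next
  case (insert i J)
  then show ?case
    using has_H10_gradient_lincomb[OF \<Omega>, of "w i" "g i" _ _ "c i" 1] by simp
qed

section \<open>The error of the energy projection on a cluster\<close>

text \<open>A combination \<open>v = \<Sum> c\<^sub>i u\<^sub>i\<close> of eigenfunctions solves the source problem with datum
  \<open>f = \<Sum> \<lambda>\<^sub>i c\<^sub>i u\<^sub>i\<close>, and orthonormality gives \<open>\<parallel>f\<parallel> \<le> \<lambda>\<^sub>N \<parallel>v\<parallel>\<close>. This turns the estimate for the
  source problem into one for the eigenvalue problem.\<close>

lemma cluster_function_weak_solution:
  assumes \<Omega>: "open \<Omega>" "bounded \<Omega>"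
    and eig: "dirichlet_eigensystem \<Omega> lam u" and n: "1 \<le> n"
    and v: "v \<in> unit_functions \<Omega> (L2_span \<Omega> {n..N} u)"
  obtains f where "f \<in> L2 \<Omega>" "weak_solution \<Omega> f v" "L2_norm \<Omega> f \<le> lam N"
proof -
  have vE: "v \<in> L2_span \<Omega> {n..N} u" and v1: "L2_norm \<Omega> v = 1"
    using v by (simp_all add: unit_functions_def)
  obtain J c where vL: "v \<in> L2 \<Omega>" and J: "finite J" "J \<subseteq> {n..N}"
    and vae: "AE x in lebesgue_on \<Omega>. v x = (\<Sum>i\<in>J. c i * u i x)"
    using vE by (rule L2_spanE)
  have J1: "i \<in> {1..}" if "i \<in> J" for i using that J n by auto
  have E: "\<forall>i\<in>{1..}. lam i > 0" "mono_on {1..} lam"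
      "\<forall>i\<in>{1..}. weak_eigenfunction \<Omega> (H10 \<Omega>) (lam i) (u i)"
      "\<forall>i\<in>{1..}. \<forall>j\<in>{1..}. L2_inner \<Omega> (u i) (u j) = of_bool (i = j)"
    using eig[unfolded dirichlet_eigensystem_def eigensystem_def] by - (elim conjE, assumption)+
  have uH: "u i \<in> H10 \<Omega>" and ueq: "\<And>w. w \<in> H10 \<Omega> \<Longrightarrow> energy_inner \<Omega> (u i) w = lam i * L2_inner \<Omega> (u i) w"
    if "i \<in> J" for i
    using E(3) J1[OF that] by (auto simp: weak_eigenfunction_def)
  have uL: "u i \<in> L2 \<Omega>" if "i \<in> J" for i using H10_L2[OF uH[OF that]] .
  have on: "L2_inner \<Omega> (u i) (u j) = of_bool (i = j)" if "i \<in> J" "j \<in> J" for i j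
    using E(4) J1 that by blast
  have lin: "(\<lambda>x. \<Sum>i\<in>J. d i * u i x) \<in> L2 \<Omega>" for d
    using L2_sum[OF J(1), of "\<lambda>i x. d i *\<^sub>R u i x"] uL L2_scale by fastforce
  let ?f = "\<lambda>x. \<Sum>i\<in>J. (lam i * c i) * u i x"
  have grad_v: "has_H10_gradient \<Omega> v (\<lambda>x. \<Sum>i\<in>J. c i *\<^sub>R grad \<Omega> (u i) x)"
    using has_H10_gradient_AE[OF \<Omega> has_H10_gradient_sum[OF \<Omega> J(1) has_H10_gradient_grad[OF uH]] vL vae]
    by simp
  have gL: "grad \<Omega> (u i) \<in> L2 \<Omega>" if "i \<in> J" for i
    using has_H10_gradient_L2[OF has_H10_gradient_grad[OF uH[OF that]]] by simp
  have "energy_inner \<Omega> v w = L2_inner \<Omega> ?f w" if w: "w \<in> H10 \<Omega>" for w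
  proof -
    have wL: "w \<in> L2 \<Omega>" and gwL: "grad \<Omega> w \<in> L2 \<Omega>"
      using has_H10_gradient_L2[OF has_H10_gradient_grad[OF w]] by auto
    have "energy_inner \<Omega> v w = (\<Sum>i\<in>J. c i * energy_inner \<Omega> (u i) w)"
      using L2_inner_sum_left[of J "\<lambda>i x. c i *\<^sub>R grad \<Omega> (u i) x" \<Omega> "grad \<Omega> w"] gL gwL
      unfolding energy_inner_eq[OF \<Omega> grad_v w]
      by (simp add: energy_inner_def L2_scale L2_inner_scale_left)
    also have "\<dots> = (\<Sum>i\<in>J. (lam i * c i) * L2_inner \<Omega> (u i) w)"
      using ueq[OF _ w] by (intro sum.cong) auto
    also have "\<dots> = (\<Sum>i\<in>J. L2_inner \<Omega> (\<lambda>x. (lam i * c i) *\<^sub>R u i x) w)"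
      by (simp only: L2_inner_scale_left)
    also have "\<dots> = L2_inner \<Omega> ?f w"
      using L2_inner_sum_left[of J "\<lambda>i x. (lam i * c i) *\<^sub>R u i x" \<Omega> w] uL wL L2_scale
      by fastforce
    finally show ?thesis .
  qed
  then have sol: "weak_solution \<Omega> ?f v"
    using grad_v by (auto simp: weak_solution_def H10_def)
  have "J \<noteq> {}"
  proof
    assume "J = {}"
    with vae have "L2_norm \<Omega> v = L2_norm \<Omega> (\<lambda>x. 0 :: real)"
      by (intro L2_norm_cong_AE[OF vL L2_zero]) simp
    then show False using v1 by (simp add: L2_norm_def L2_inner_def)
  qed
  then have N: "n \<le> N" using J(2) by auto
  then have lamN: "0 < lam N" using E(1) n by auto
  have "(\<Sum>i\<in>J. (c i)\<^sup>2) = (L2_norm \<Omega> v)\<^sup>2"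
    using L2_norm_orthonormal_sum[OF J(1) uL on] L2_norm_cong_AE[OF vL lin vae] by simp
  then have c1: "(\<Sum>i\<in>J. (c i)\<^sup>2) = 1" using v1 by simp
  have "(L2_norm \<Omega> ?f)\<^sup>2 = (\<Sum>i\<in>J. (lam i * c i)\<^sup>2)"
    using L2_norm_orthonormal_sum[OF J(1) uL on, of "\<lambda>i. lam i * c i"] by simp
  also have "\<dots> \<le> (\<Sum>i\<in>J. (lam N)\<^sup>2 * (c i)\<^sup>2)"
  proof (rule sum_mono)
    fix i assume i: "i \<in> J"
    have "0 < lam i" "lam i \<le> lam N"
      using E(1) J1[OF i] i J(2) N n by (auto intro!: mono_onD[OF E(2)])
    then show "(lam i * c i)\<^sup>2 \<le> (lam N)\<^sup>2 * (c i)\<^sup>2"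
      by (auto simp: power_mult_distrib intro!: mult_right_mono power_mono)
  qed
  also have "\<dots> = (lam N)\<^sup>2" using c1 by (simp flip: sum_distrib_left)
  finally have "L2_norm \<Omega> ?f \<le> lam N"
    by (rule power2_le_imp_le) (use lamN in simp)
  with lin sol show ?thesis by (rule that)
qed

lemma cluster_energy_projection_error:
  assumes "open \<Omega>" "bounded \<Omega>" "dirichlet_eigensystem \<Omega> lam u" "1 \<le> n"
    and "a_priori_estimate \<Omega> P\<^sub>h C\<^sub>h"
    and "v \<in> unit_functions \<Omega> (L2_span \<Omega> {n..N} u)"
  shows "L2_norm \<Omega> (v - P\<^sub>h v) \<le> lam N * C\<^sub>h\<^sup>2"
proof -
  obtain f where f: "f \<in> L2 \<Omega>" "weak_solution \<Omega> f v" "L2_norm \<Omega> f \<le> lam N"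
    using cluster_function_weak_solution[OF assms(1-4,6)] .
  have "L2_norm \<Omega> (v - P\<^sub>h v) \<le> C\<^sub>h * energy_norm \<Omega> (v - P\<^sub>h v) \<and>
      C\<^sub>h * energy_norm \<Omega> (v - P\<^sub>h v) \<le> C\<^sub>h\<^sup>2 * L2_norm \<Omega> f"
    using assms(5)[unfolded a_priori_estimate_def, rule_format, OF f(1,2)] by simp
  then have "L2_norm \<Omega> (v - P\<^sub>h v) \<le> C\<^sub>h\<^sup>2 * L2_norm \<Omega> f" by linarith
  also have "\<dots> \<le> C\<^sub>h\<^sup>2 * lam N" using f(3) by (intro mult_left_mono) auto
  finally show ?thesis by (simp add: mult.commute)
qed

section \<open>Clusters resolved exactly by the discrete space\<close>

text \<open>A discrete eigenvalue with an index below \<open>n\<close> is at most the one with index \<open>n - 1\<close>, hence below the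
  range \<open>[a, b]\<close> of the cluster, and one with an index above \<open>N\<close> lies above that range.\<close>

lemma mono_on_cluster_index:
  fixes lam\<^sub>h :: "nat \<Rightarrow> real"
  assumes "mono_on {1..d} lam\<^sub>h" "j \<in> {1..d}" "lam\<^sub>h j = \<mu>" "a \<le> \<mu>" "\<mu> \<le> b"
    and "n > 1 \<Longrightarrow> lam\<^sub>h (n - 1) < a" and "N < d \<Longrightarrow> b < lam\<^sub>h (N + 1)"
    and "n \<le> d"
  shows "j \<in> {n..N}"
proof -
  have "n \<le> j"
  proof (rule ccontr)
    assume "\<not> n \<le> j"
    then have "n - 1 \<in> {1..d}" "j \<le> n - 1" "n > 1"
      using assms(2,8) unfolding atLeastAtMost_iff by - arith+
    then have "lam\<^sub>h j \<le> lam\<^sub>h (n - 1)" "lam\<^sub>h (n - 1) < a"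
      using mono_onD[OF assms(1,2)] assms(6) by blast+
    then show False using assms(3,4) by simp
  qed
  moreover have "j \<le> N"
  proof (rule ccontr)
    assume "\<not> j \<le> N"
    then have "N + 1 \<in> {1..d}" "N + 1 \<le> j" "N < d"
      using assms(2) unfolding atLeastAtMost_iff by - arith+
    then have "lam\<^sub>h (N + 1) \<le> lam\<^sub>h j" "b < lam\<^sub>h (N + 1)"
      using mono_onD[OF assms(1) _ assms(2)] assms(7) by blast+
    then show False using assms(3,5) by simp
  qed
  ultimately show ?thesis by simp
qed

text \<open>Equality almost everywhere is the right form of the premise because an eigenfunction is
  compared with its projection, which can differ from it on a null set.\<close>

lemma L2_span_trans:
  assumes v: "v \<in> L2_span \<Omega> I u" and I: "\<And>i. i \<in> I \<Longrightarrow> \<exists>w\<in>L2_span \<Omega> K y. AE x in lebesgue_on \<Omega>. u i x = w x"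
  shows "v \<in> L2_span \<Omega> K y"
proof -
  obtain J c where vL: "v \<in> L2 \<Omega>" and J: "finite J" "J \<subseteq> I"
    and vae: "AE x in lebesgue_on \<Omega>. v x = (\<Sum>i\<in>J. c i * u i x)"
    using v by (rule L2_spanE)
  have expand: "\<forall>i\<in>J. \<exists>A d. finite A \<and> A \<subseteq> K \<and> (AE x in lebesgue_on \<Omega>. u i x = (\<Sum>j\<in>A. d j * y j x))"
  proof
    fix i assume "i \<in> J"
    then obtain w where w: "w \<in> L2_span \<Omega> K y" "AE x in lebesgue_on \<Omega>. u i x = w x"
      using I J(2) by blast
    obtain A d where A: "finite A" "A \<subseteq> K" "AE x in lebesgue_on \<Omega>. w x = (\<Sum>j\<in>A. d j * y j x)"
      using w(1) by (rule L2_spanE)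
    have "AE x in lebesgue_on \<Omega>. u i x = (\<Sum>j\<in>A. d j * y j x)"
      using w(2) A(3) by eventually_elim simp
    with A show "\<exists>A d. finite A \<and> A \<subseteq> K \<and> (AE x in lebesgue_on \<Omega>. u i x = (\<Sum>j\<in>A. d j * y j x))"
      by blast
  qed
  obtain A where A': "\<forall>i\<in>J. \<exists>d. finite (A i) \<and> A i \<subseteq> K \<and>
      (AE x in lebesgue_on \<Omega>. u i x = (\<Sum>j\<in>A i. d j * y j x))"
    using bchoice[OF expand] by (rule exE)
  obtain d where A: "\<forall>i\<in>J. finite (A i) \<and> A i \<subseteq> K \<and>
      (AE x in lebesgue_on \<Omega>. u i x = (\<Sum>j\<in>A i. d i j * y j x))"
    using bchoice[OF A'] by (rule exE)
  let ?B = "\<Union>i\<in>J. A i"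
  let ?e = "\<lambda>j. \<Sum>i\<in>J. c i * (if j \<in> A i then d i j else 0)"
  have B: "finite ?B" "?B \<subseteq> K" using A J(1) by auto
  have "AE x in lebesgue_on \<Omega>. \<forall>i\<in>J. u i x = (\<Sum>j\<in>A i. d i j * y j x)"
    using A J(1) by (intro AE_finite_allI) auto
  with vae have "AE x in lebesgue_on \<Omega>. v x = (\<Sum>j\<in>?B. ?e j * y j x)"
  proof eventually_elim
    case (elim x)
    have "u i x = (\<Sum>j\<in>?B. (if j \<in> A i then d i j else 0) * y j x)" if i: "i \<in> J" for i
    proof -
      have "u i x = (\<Sum>j\<in>A i. (if j \<in> A i then d i j else 0) * y j x)"
        using elim(2) i by simp
      also have "\<dots> = (\<Sum>j\<in>?B. (if j \<in> A i then d i j else 0) * y j x)"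
        using B(1) i by (intro sum.mono_neutral_left) auto
      finally show ?thesis .
    qed
    then have "v x = (\<Sum>i\<in>J. \<Sum>j\<in>?B. c i * (if j \<in> A i then d i j else 0) * y j x)"
      using elim(1) by (simp add: sum_distrib_left mult.assoc)
    also have "\<dots> = (\<Sum>j\<in>?B. ?e j * y j x)"
      by (subst sum.swap) (simp add: sum_distrib_right)
    finally show ?case .
  qed
  then show ?thesis by (rule L2_spanI[OF vL B])
qed

lemma fe_space_subset_H10: "fe_space \<Omega> \<T> p \<subseteq> H10 \<Omega>"
  by (auto simp: fe_space_def)

text \<open>If the projection reproduces the cluster, each \<open>u\<^sub>i\<close> agrees with an element of the discrete
  space and is a discrete eigenfunction for the same eigenvalue. Completeness of the
  discrete eigensystem expands it in discrete eigenfunctions for that eigenvalue, and the gap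
  assumption confines their indices to the cluster.\<close>

lemma cluster_subset_discrete_cluster:
  assumes \<Omega>: "open \<Omega>" "bounded \<Omega>" and VH: "V\<^sub>h \<subseteq> H10 \<Omega>"
    and eig: "dirichlet_eigensystem \<Omega> lam u" and disc: "discrete_eigensystem \<Omega> V\<^sub>h lam\<^sub>h u\<^sub>h"
    and n: "1 \<le> n" and N: "N \<le> L2_dim \<Omega> V\<^sub>h"
    and gap: "n > 1 \<Longrightarrow> lam\<^sub>h (n - 1) < lam n" "N < L2_dim \<Omega> V\<^sub>h \<Longrightarrow> lam N < lam\<^sub>h (N + 1)"
    and proj: "energy_projector \<Omega> V\<^sub>h P\<^sub>h"
    and exact: "\<And>v. v \<in> unit_functions \<Omega> (L2_span \<Omega> {n..N} u) \<Longrightarrow> L2_norm \<Omega> (v - P\<^sub>h v) = 0"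
  shows "L2_span \<Omega> {n..N} u \<subseteq> L2_span \<Omega> {n..N} u\<^sub>h"
proof
  fix v assume v: "v \<in> L2_span \<Omega> {n..N} u"
  have "\<exists>w\<in>L2_span \<Omega> {n..N} u\<^sub>h. AE x in lebesgue_on \<Omega>. u i x = w x" if i: "i \<in> {n..N}" for i
  proof -
    have i1: "i \<in> {1..}" using i n by auto
    have uH: "u i \<in> H10 \<Omega>" and ueq: "\<And>w. w \<in> H10 \<Omega> \<Longrightarrow> energy_inner \<Omega> (u i) w = lam i * L2_inner \<Omega> (u i) w"
      and unorm: "L2_inner \<Omega> (u i) (u i) = 1"
      and mono: "mono_on {1..} lam"
      using eig i1 unfolding dirichlet_eigensystem_def eigensystem_def weak_eigenfunction_def by auto
    have uL: "u i \<in> L2 \<Omega>" using uH by (rule H10_L2)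
    have "u i \<in> L2_span \<Omega> {n..N} u"
      using uL i by (rule L2_span_generator)
    then have "L2_norm \<Omega> (u i - P\<^sub>h (u i)) = 0"
      using unorm by (intro exact) (simp add: unit_functions_def L2_norm_def)
    moreover have PV: "P\<^sub>h (u i) \<in> V\<^sub>h" using proj uH by (auto simp: energy_projector_def)
    then have PL: "P\<^sub>h (u i) \<in> L2 \<Omega>" using VH by (auto intro: H10_L2)
    ultimately have "AE x in lebesgue_on \<Omega>. u i x - P\<^sub>h (u i) x = 0"
      using L2_norm_eq_0_imp_AE[OF L2_diff[OF uL PL]] by (simp add: fun_diff_def)
    then have ae: "AE x in lebesgue_on \<Omega>. u i x = P\<^sub>h (u i) x"
      and ae': "AE x in lebesgue_on \<Omega>. P\<^sub>h (u i) x = u i x" by auto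
    have "energy_inner \<Omega> (P\<^sub>h (u i)) w = lam i * L2_inner \<Omega> (P\<^sub>h (u i)) w" if "w \<in> V\<^sub>h" for w
    proof -
      have w: "w \<in> H10 \<Omega>" using that VH by auto
      show ?thesis
        using H10_AE_eq(2)[OF \<Omega> uH PL ae' w] ueq[OF w]
          L2_inner_cong_AE[OF PL uL H10_L2[OF w] H10_L2[OF w] ae'] by simp
    qed
    then have "weak_eigenfunction \<Omega> V\<^sub>h (lam i) (P\<^sub>h (u i))"
      using PV by (auto simp: weak_eigenfunction_def)
    then have span: "P\<^sub>h (u i) \<in> L2_span \<Omega> {j \<in> {1..L2_dim \<Omega> V\<^sub>h}. lam\<^sub>h j = lam i} u\<^sub>h"
      and monoh: "mono_on {1..L2_dim \<Omega> V\<^sub>h} lam\<^sub>h"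
      using disc[unfolded discrete_eigensystem_def eigensystem_def] by blast+
    have "lam n \<le> lam i" "lam i \<le> lam N"
      using i n by (auto intro!: mono_onD[OF mono])
    then have "{j \<in> {1..L2_dim \<Omega> V\<^sub>h}. lam\<^sub>h j = lam i} \<subseteq> {n..N}"
      using mono_on_cluster_index[OF monoh _ _ _ _ gap] i N by auto
    then have "P\<^sub>h (u i) \<in> L2_span \<Omega> {n..N} u\<^sub>h"
      using span L2_span_mono by blast
    with ae show ?thesis by blast
  qed
  with v show "v \<in> L2_span \<Omega> {n..N} u\<^sub>h" by (rule L2_span_trans)
qed

section \<open>The distance between the clusters\<close>

text \<open>The set of admissible factors is the closed half-line starting at the supremum of \<open>a\<close> divided by
  \<open>M\<close>, so the least one exists and is itself admissible.\<close>

lemma Least_uniform_factor: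
  fixes a :: "'i \<Rightarrow> real"
  assumes "U \<noteq> {}" "bdd_above (a ` U)" "\<And>u. u \<in> U \<Longrightarrow> 0 \<le> a u" "0 < M"
  defines "\<beta> \<equiv> LEAST \<beta>. \<beta> \<ge> 0 \<and> (\<forall>u\<in>U. a u \<le> \<beta> * M)"
  shows "0 \<le> \<beta>" and "u \<in> U \<Longrightarrow> a u \<le> \<beta> * M"
proof -
  let ?s = "(SUP u\<in>U. a u) / M"
  have up: "a u \<le> (SUP u\<in>U. a u)" if "u \<in> U" for u
    using assms(2) that by (rule cSUP_upper2) simp
  have s0: "0 \<le> ?s"
    using assms(1,3,4) up by (metis all_not_in_conv divide_nonneg_pos order_trans)
  have "\<beta> = ?s"
    unfolding \<beta>_def
  proof (rule Least_equality)
    show "?s \<ge> 0 \<and> (\<forall>u\<in>U. a u \<le> ?s * M)" using s0 up assms(4) by simp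
    fix y assume "y \<ge> 0 \<and> (\<forall>u\<in>U. a u \<le> y * M)"
    then show "?s \<le> y" using assms(1,4) by (simp add: cSUP_least pos_divide_le_eq)
  qed
  then show "0 \<le> \<beta>" "u \<in> U \<Longrightarrow> a u \<le> \<beta> * M" using s0 up assms(4) by auto
qed

theorem theorem1:
  fixes \<Omega> :: "'a::euclidean_space set" and \<T> :: "'a set set" and p n N :: nat
    and lam lam\<^sub>h :: "nat \<Rightarrow> real" and u u\<^sub>h :: "nat \<Rightarrow> 'a \<Rightarrow> real"
    and V\<^sub>h E E\<^sub>h :: "('a \<Rightarrow> real) set"
    and P\<^sub>h \<Pi>\<^sub>h :: "('a \<Rightarrow> real) \<Rightarrow> ('a \<Rightarrow> real)" and C\<^sub>h :: real
  assumes "bounded_lipschitz_polytope \<Omega>"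
    and "conforming_simplicial_mesh \<Omega> \<T>"
    and "V\<^sub>h = fe_space \<Omega> \<T> p"
    and "dirichlet_eigensystem \<Omega> lam u"
    and "discrete_eigensystem \<Omega> V\<^sub>h lam\<^sub>h u\<^sub>h"
    and "1 \<le> n" and "n \<le> N" and "N \<le> L2_dim \<Omega> V\<^sub>h"
    and "E = L2_span \<Omega> {n..N} u"
    and "E\<^sub>h = L2_span \<Omega> {n..N} u\<^sub>h"
    and "n > 1 \<Longrightarrow> lam\<^sub>h (n - 1) < lam n"
    and "N < L2_dim \<Omega> V\<^sub>h \<Longrightarrow> lam N < lam\<^sub>h (N + 1)"
    and "energy_projector \<Omega> V\<^sub>h P\<^sub>h"
    and "L2_projector \<Omega> E\<^sub>h \<Pi>\<^sub>h"
    and "C\<^sub>h > 0"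
    and "a_priori_estimate \<Omega> P\<^sub>h C\<^sub>h"
  shows "directed_distance \<Omega> E E\<^sub>h \<le> (1 + cluster_beta \<Omega> E P\<^sub>h \<Pi>\<^sub>h) * lam N * C\<^sub>h\<^sup>2"
proof -
  have \<Omega>: "open \<Omega>" "bounded \<Omega>" using assms(1) by (auto simp: bounded_lipschitz_polytope_def)
  have VH: "V\<^sub>h \<subseteq> H10 \<Omega>" unfolding assms(3) by (rule fe_space_subset_H10)
  let ?U = "unit_functions \<Omega> E"
  let ?L = "lam N * C\<^sub>h\<^sup>2"
  let ?err = "\<lambda>v. L2_norm \<Omega> (v - P\<^sub>h v)"
  let ?res = "\<lambda>v. L2_norm \<Omega> (P\<^sub>h v - \<Pi>\<^sub>h (P\<^sub>h v))"
  let ?M = "SUP v\<in>?U. ?err v"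
  let ?\<beta> = "cluster_beta \<Omega> E P\<^sub>h \<Pi>\<^sub>h"
  have lamN: "0 < lam N"
    using assms(4,6,7) by (auto simp: dirichlet_eigensystem_def eigensystem_def)
  have L0: "0 \<le> ?L" using lamN by simp
  have err: "?err v \<le> ?L" if "v \<in> ?U" for v
    using cluster_energy_projection_error[OF \<Omega> assms(4,6,16)] that unfolding assms(9) by blast
  then have bdd_err: "bdd_above (?err ` ?U)" by (auto intro!: bdd_aboveI2)
  have UH: "v \<in> H10 \<Omega>" and U1: "L2_norm \<Omega> v = 1" if v: "v \<in> ?U" for v
    using cluster_function_weak_solution[OF \<Omega> assms(4,6) v[unfolded assms(9)]] v
    by (auto simp: weak_solution_def unit_functions_def)
  have UL: "v \<in> L2 \<Omega>" if "v \<in> ?U" for v using UH[OF that] by (rule H10_L2)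
  have PH: "P\<^sub>h v \<in> H10 \<Omega>" if "v \<in> ?U" for v
    using assms(13) UH[OF that] VH by (auto simp: energy_projector_def)
  have PL: "P\<^sub>h v \<in> L2 \<Omega>" if "v \<in> ?U" for v using PH[OF that] by (rule H10_L2)
  have QE: "\<Pi>\<^sub>h (P\<^sub>h v) \<in> E\<^sub>h" if "v \<in> ?U" for v
    using assms(14) PH[OF that] by (auto simp: L2_projector_def)
  have QL: "\<Pi>\<^sub>h (P\<^sub>h v) \<in> L2 \<Omega>" if "v \<in> ?U" for v
    using QE[OF that] unfolding assms(10) by (simp add: L2_span_def)
  have Une: "?U \<noteq> {}"
  proof -
    have uH: "u n \<in> H10 \<Omega>" and un: "L2_inner \<Omega> (u n) (u n) = 1"
      using assms(4,6) unfolding dirichlet_eigensystem_def eigensystem_def weak_eigenfunction_def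
      by auto
    have "u n \<in> E"
      using H10_L2[OF uH] assms(7) unfolding assms(9) by (intro L2_span_generator) auto
    then have "u n \<in> ?U" using un by (simp add: unit_functions_def L2_norm_def)
    then show ?thesis by blast
  qed
  have bdd_dist: "bdd_below ((\<lambda>w. L2_norm \<Omega> (v - w)) ` E\<^sub>h)" for v
    by (auto intro!: bdd_belowI2 L2_norm_nonneg)
  have "(INF w\<in>E\<^sub>h. L2_norm \<Omega> (v - w)) \<le> (1 + ?\<beta>) * ?L" if v: "v \<in> ?U" for v
  proof (cases "\<forall>v\<in>?U. ?err v = 0")
    case True
    have "v \<in> E\<^sub>h"
      using cluster_subset_discrete_cluster[OF \<Omega> VH assms(4,5,6,8,11,12,13)] True v
      unfolding assms(9,10) unit_functions_def by blast
    then have "(INF w\<in>E\<^sub>h. L2_norm \<Omega> (v - w)) \<le> L2_norm \<Omega> (v - v)"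
      by (intro cINF_lower bdd_dist)
    also have "\<dots> = 0" by (simp add: L2_norm_def L2_inner_def)
    finally show ?thesis using True L0 by (simp add: cluster_beta_def)
  next
    case False
    then obtain z where z: "z \<in> ?U" "?err z \<noteq> 0" by blast
    have M: "0 < ?M" "?M \<le> ?L"
      using z L2_norm_nonneg[of \<Omega> "z - P\<^sub>h z"] cSUP_upper[OF z(1) bdd_err] Une err
      by (auto intro: cSUP_least)
    \<comment> \<open>Any uniform bound on the residuals makes \<open>\<beta>\<close> well defined.\<close>
    have "?res y \<le> 1 + ?L" if y: "y \<in> ?U" for y
    proof -
      have "L2_inner \<Omega> (P\<^sub>h y - \<Pi>\<^sub>h (P\<^sub>h y)) (\<Pi>\<^sub>h (P\<^sub>h y)) = 0"
        using assms(14) PH[OF y] QE[OF y] by (auto simp: L2_projector_def)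
      then have "?res y \<le> L2_norm \<Omega> (P\<^sub>h y)"
        using L2_norm_orthogonal_residual_le[OF PL[OF y] QL[OF y]] by (simp add: fun_diff_def)
      also have "\<dots> \<le> ?err y + L2_norm \<Omega> y"
        using L2_norm_triangle[OF L2_diff[OF PL[OF y] UL[OF y]] UL[OF y]]
        by (simp add: fun_diff_def L2_norm_minus_commute[of \<Omega> y])
      finally show ?thesis using err[OF y] U1[OF y] by simp
    qed
    then have bdd_res: "bdd_above (?res ` ?U)" by (auto intro!: bdd_aboveI2)
    have \<beta>: "?\<beta> = (LEAST \<beta>. \<beta> \<ge> 0 \<and> (\<forall>u\<in>?U. ?res u \<le> \<beta> * ?M))"
      unfolding cluster_beta_def if_not_P[OF False] ..
    have \<beta>0: "0 \<le> ?\<beta>" and res: "?res v \<le> ?\<beta> * ?M"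
      using Least_uniform_factor[OF Une bdd_res L2_norm_nonneg M(1)] v unfolding \<beta> by auto
    have "(INF w\<in>E\<^sub>h. L2_norm \<Omega> (v - w)) \<le> L2_norm \<Omega> (v - \<Pi>\<^sub>h (P\<^sub>h v))"
      using QE[OF v] by (intro cINF_lower bdd_dist)
    also have "\<dots> \<le> ?err v + ?res v"
      using L2_norm_triangle_diff[OF UL[OF v] PL[OF v] QL[OF v]] by (simp add: fun_diff_def)
    also have "\<dots> \<le> ?M + ?\<beta> * ?M"
      using cSUP_upper[OF v bdd_err] res by simp
    also have "\<dots> = (1 + ?\<beta>) * ?M" by (simp add: algebra_simps)
    also have "\<dots> \<le> (1 + ?\<beta>) * ?L"
      using M(2) \<beta>0 by (intro mult_left_mono) auto
    finally show ?thesis .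
  qed
  then have "directed_distance \<Omega> E E\<^sub>h \<le> (1 + ?\<beta>) * ?L"
    unfolding directed_distance_def using Une by (intro cSUP_least)
  then show ?thesis by (simp add: mult.assoc)
qed

end
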